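(* There exist positive absolute constants $c_1,c_2$ with the following property. Let $\alpha\ge 1$, and let $a:[0,\infty)\to(0,\infty)$ be a log-concave function (i.e. $\log a$ is concave), of class $C^2$ on $(0,\infty)$, with $\lim_{t\to\infty}\frac{\log a(t)}{t}=-\infty$ and $a(t)\ge\exp\left(-t(\log t)^{\alpha}\right)$ for $t\ge 1$. Put $a_n=a(n)$ for $n=0,1,2,\ldots$ and let $f(z)=\sum_{n\ge 0}\phi_n a_n z^n$, where the $\phi_n$ are independent standard complex Gaussian random variables. Then for every $\epsilon>0$ there is a set $E\subset[1,\infty)$ of finite logarithmic measure such that for all $r\in[1,\infty)\setminus E$, $$S(r)-c_1\left(S(r)\right)^{0.9+\epsilon}\le p_H(r)\le S(r)+c_2\left(S(r)\right)^{0.5+\epsilon}.$$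
   Context: A standard complex Gaussian variable has density $\frac1\pi e^{-|w|^2}$ on $\mathbb{C}$. Under the stated assumptions the series $f$ almost surely has infinite radius of convergence. For $r\geq 1$: - $P_H(r)$ is the probability that $f$ has no zeros in the disk $\{|z|\le r\}$, and $p_H(r)=-\log P_H(r)$. - $\mathcal{N}_1(r)=\{n\ge 0:\ \log(a_nr^n)\ge 0\}$ (a finite set of integers), and $S(r)=2\sum_{n\in\mathcal{N}_1(r)}\log(a_nr^n)$. A measurable set $E\subset[1,\infty)$ has finite logarithmic measure if $\int_E\frac{dt}{t}<\infty$. Absolute constants do not depend on $a$, $\alpha$, $\epsilon$ or $r$. *)

theory Defs
  imports "HOL-Probability.Probability"
begin

definition C2_on :: "real set \<Rightarrow> (real \<Rightarrow> real) \<Rightarrow> bool" where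
  "C2_on U g \<longleftrightarrow> (\<exists>g' g''.
     (\<forall>t\<in>U. (g has_real_derivative g' t) (at t)) \<and>
     (\<forall>t\<in>U. (g' has_real_derivative g'' t) (at t)) \<and>
     continuous_on U g'')"

definition indep_std_complex_gaussians :: "'w measure \<Rightarrow> (nat \<Rightarrow> 'w \<Rightarrow> complex) \<Rightarrow> bool" where
  "indep_std_complex_gaussians M \<phi> \<longleftrightarrow>
     prob_space.indep_vars M (\<lambda>_. borel) \<phi> UNIV \<and>
     (\<forall>n. distributed M lborel (\<phi> n) (\<lambda>w. ennreal (exp (- (cmod w)\<^sup>2) / pi)))"

definition gaussian_series ::
    "(nat \<Rightarrow> 'w \<Rightarrow> complex) \<Rightarrow> (real \<Rightarrow> real) \<Rightarrow> 'w \<Rightarrow> complex \<Rightarrow> complex" where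
  "gaussian_series \<phi> a \<omega> z = (\<Sum>n. \<phi> n \<omega> * of_real (a (real n)) * z ^ n)"

text \<open>
  The series has infinite radius of convergence only almost surely, and on the exceptional
  null set the value of the infinite sum is unspecified. Intersecting with the
  event of convergence does not change the probability and makes the set measurable
  in any (possibly incomplete) probability space.
\<close>

definition hole_event ::
    "'w measure \<Rightarrow> (nat \<Rightarrow> 'w \<Rightarrow> complex) \<Rightarrow> (real \<Rightarrow> real) \<Rightarrow> real \<Rightarrow> 'w set" where
  "hole_event M \<phi> a r =
     {\<omega> \<in> space M. conv_radius (\<lambda>n. \<phi> n \<omega> * of_real (a (real n))) = \<infinity> \<and>
        (\<forall>z. cmod z \<le> r \<longrightarrow> gaussian_series \<phi> a \<omega> z \<noteq> 0)}"

definition P_H ::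
    "'w measure \<Rightarrow> (nat \<Rightarrow> 'w \<Rightarrow> complex) \<Rightarrow> (real \<Rightarrow> real) \<Rightarrow> real \<Rightarrow> real" where
  "P_H M \<phi> a r = measure M (hole_event M \<phi> a r)"

text \<open>
  Extended real values, so that \<open>- log 0 = \<infinity>\<close>; the real logarithm has \<open>ln 0 = 0\<close>, which
  would make an upper bound on \<open>- ln (P_H M \<phi> a r)\<close> meaningless at probability 0.
\<close>

definition p_H ::
    "'w measure \<Rightarrow> (nat \<Rightarrow> 'w \<Rightarrow> complex) \<Rightarrow> (real \<Rightarrow> real) \<Rightarrow> real \<Rightarrow> ereal" where
  "p_H M \<phi> a r = (if P_H M \<phi> a r = 0 then \<infinity> else ereal (- ln (P_H M \<phi> a r)))"

definition N1 :: "(real \<Rightarrow> real) \<Rightarrow> real \<Rightarrow> nat set" where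
  "N1 a r = {n. ln (a (real n) * r ^ n) \<ge> 0}"

definition S :: "(real \<Rightarrow> real) \<Rightarrow> real \<Rightarrow> real" where
  "S a r = 2 * (\<Sum>n\<in>N1 a r. ln (a (real n) * r ^ n))"

definition finite_log_measure :: "real set \<Rightarrow> bool" where
  "finite_log_measure E \<longleftrightarrow>
     E \<in> sets lebesgue \<and> E \<subseteq> {1..} \<and> (\<integral>\<^sup>+t\<in>E. ennreal (1 / t) \<partial>lebesgue) < \<infinity>"

end

theory Submission
  imports Defs "HOL-Complex_Analysis.Complex_Analysis" "HOL-Real_Asymp.Real_Asymp"
begin

text \<open>
  Write \<open>h n = ln (a n * r ^ n)\<close>, let \<open>N\<close> be the largest index with \<open>h N \<ge> 0\<close>, and \<open>m = N + 1\<close>.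
  As a function of \<open>ln r\<close>, \<open>S\<close> has slope at least \<open>N\<^sup>2\<close>, so a Borel type growth lemma gives
  \<open>N\<^sup>2 \<le> S powr (1 + \<epsilon>)\<close> off a set of finite logarithmic measure. By concavity the terms of
  index \<open>n > N\<close> then decay geometrically, at a rate at least \<open>S powr (- \<epsilon>) / 8\<close>.

  Upper bound on \<open>p_H\<close>: a hole appears if \<open>\<phi> 0\<close> is a small power of \<open>S\<close>, \<open>\<bar>\<phi> n\<bar> \<le> exp (- h n) / N\<close> for
  \<open>1 \<le> n \<le> N\<close>, and the remaining coefficients are of moderate size; the cost of this is
  \<open>S + O(N ln N)\<close> plus a small power of \<open>S\<close>.

  Lower bound on \<open>p_H\<close>: if \<open>f\<close> has no zeros, \<open>log f\<close> is holomorphic, and its average over \<open>m\<close> equidistributed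
  points of the circle of radius \<open>q * r\<close>, where \<open>q ^ m = 1 / S\<close>, agrees with its value at 0 up to \<open>O(1)\<close>,
  by the Schwarz lemma applied to a function invariant under rotation by \<open>2 * \<pi> / m\<close>. Hence the product of the
  values of \<open>\<bar>f\<bar>\<close> at these points is at most \<open>exp (O(m * ln S))\<close>. Given the coefficients of index \<open>\<ge> m\<close>,
  these values are an affine image of \<open>m\<close> independent Gaussians under a Vandermonde matrix whose determinant
  is at least \<open>exp (S / 2 - O(m * ln S))\<close> in modulus. Markov's inequality for the
  product of the \<open>\<bar>f\<bar> powr (- 2 + 1 / S)\<close> shows that the event has probability at most \<open>exp (- S + O(m * ln S))\<close>.
  This gives the exponent \<open>0.5 + \<epsilon>\<close> for the lower bound as well.
\<close>

section \<open>Averages of the logarithm over roots of unity\<close>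

text \<open>\<open>Schwarz_Lemma\<close> takes the strict bound \<open>norm (f z) < 1\<close>, so it
  is applied to c f with c < 1, and c tends to 1. The weak bound passes to the quotient, so that the
  division by z can be iterated.\<close>

lemma Schwarz_quotient:
  fixes f :: "complex \<Rightarrow> complex"
  assumes hol: "f holomorphic_on ball 0 1" and f0: "f 0 = 0"
    and le1: "\<And>z. norm z < 1 \<Longrightarrow> norm (f z) \<le> 1"
  obtains h where "h holomorphic_on ball 0 1" "\<And>z. norm z < 1 \<Longrightarrow> f z = z * h z"
    "\<And>z. norm z < 1 \<Longrightarrow> norm (h z) \<le> 1"
proof -
  obtain h where h: "h holomorphic_on ball 0 1" "\<And>z. norm z < 1 \<Longrightarrow> f z = z * h z" "deriv f 0 = h 0"
    using Schwarz3[OF hol f0] by blast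
  have "norm (h z) \<le> 1" if z: "norm z < 1" for z
  proof (rule field_le_mult_one_interval)
    fix c :: real assume c: "0 < c" "c < 1"
    define g where "g = (\<lambda>z. of_real c * f z)"
    have g: "g holomorphic_on ball 0 1" "g 0 = 0"
      unfolding g_def using hol f0 by (auto intro!: holomorphic_intros)
    have less: "norm (g w) < 1" if "norm w < 1" for w
    proof -
      have "norm (g w) = c * norm (f w)" using c by (simp add: g_def norm_mult)
      also have "\<dots> \<le> c * 1" using le1[OF that] c by (intro mult_left_mono) auto
      finally show ?thesis using c by simp
    qed
    show "c * norm (h z) \<le> 1"
    proof (cases "z = 0")
      case True
      have "deriv g 0 = of_real c * deriv f 0"
        unfolding g_def by (intro deriv_cmult holomorphic_on_imp_differentiable_at[OF hol]) auto
      moreover have "norm (deriv g 0) \<le> 1"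
        using Schwarz_Lemma(2)[OF g less z] by simp
      ultimately show ?thesis using c h(3) True by (simp add: norm_mult)
    next
      case False
      have "norm (g z) \<le> norm z" using Schwarz_Lemma(1)[OF g less z] by simp
      thus ?thesis using c h(2)[OF z] False by (simp add: g_def norm_mult field_simps)
    qed
  qed
  thus ?thesis using that h by blast
qed

text \<open>The invariance forces a zero of order at least m at 0: once z^k is divided out, the
  quotient satisfies w^k h(w z) = h(z), hence h(0) = 0 while 0 < k < m, and
  \<open>Schwarz_quotient\<close> applies once more.\<close>

lemma Schwarz_rotation_invariant:
  fixes f :: "complex \<Rightarrow> complex" and w :: complex
  assumes hol: "f holomorphic_on ball 0 1" and f0: "f 0 = 0"
    and le1: "\<And>z. norm z < 1 \<Longrightarrow> norm (f z) \<le> 1"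
    and w: "norm w = 1" "\<And>k. 0 < k \<Longrightarrow> k < m \<Longrightarrow> w ^ k \<noteq> 1"
    and inv: "\<And>z. norm z < 1 \<Longrightarrow> f (w * z) = f z"
    and m: "m > 0" and z: "norm z < 1"
  shows "norm (f z) \<le> norm z ^ m"
proof -
  have "\<exists>h. h holomorphic_on ball 0 1 \<and> (\<forall>z. norm z < 1 \<longrightarrow> f z = z ^ k * h z \<and> norm (h z) \<le> 1)"
    if "0 < k" "k \<le> m" for k
    using that
  proof (induction k rule: nat_induct_non_zero)
    case 1
    show ?case using Schwarz_quotient[OF hol f0 le1] by (metis power_one_right)
  next
    case (Suc k)
    then obtain h where h: "h holomorphic_on ball 0 1"
      "\<And>z. norm z < 1 \<Longrightarrow> f z = z ^ k * h z" "\<And>z. norm z < 1 \<Longrightarrow> norm (h z) \<le> 1" by auto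
    have eq: "w ^ k * h (w * z) = h z" if "norm z < 1" "z \<noteq> 0" for z
    proof -
      have "z ^ k * (w ^ k * h (w * z)) = z ^ k * h z"
        using inv[OF that(1)] h(2)[of z] h(2)[of "w * z"] that w(1)
        by (simp add: norm_mult power_mult_distrib mult_ac)
      thus ?thesis using that by simp
    qed
    have cont: "continuous_on (ball 0 1) h" using h(1) by (rule holomorphic_on_imp_continuous_on)
    \<comment> \<open>Cancelling \<open>z ^ k\<close> gave the functional equation away from 0 only;
      continuity extends it to 0.\<close>
    have "((\<lambda>z. w ^ k * h (w * z)) \<longlongrightarrow> w ^ k * h (w * 0)) (at 0)"
    proof (intro tendsto_intros isCont_tendsto_compose[of "w * 0" h])
      show "isCont h (w * 0)" using cont by (simp add: continuous_on_eq_continuous_at)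
    qed
    moreover have "(h \<longlongrightarrow> h 0) (at 0)"
      using cont by (simp add: continuous_on_eq_continuous_at isCont_def)
    moreover have "eventually (\<lambda>z. w ^ k * h (w * z) = h z) (at 0)"
      unfolding eventually_at by (rule exI[of _ 1]) (auto intro!: eq)
    ultimately have "w ^ k * h 0 = h 0"
      using tendsto_unique[of "at (0::complex)" h "h 0" "w ^ k * h 0"]
      by (simp add: tendsto_cong)
    hence h0: "h 0 = 0" using w(2)[of k] Suc by auto
    show ?case
      using Schwarz_quotient[OF h(1) h0 h(3)] h(2) by (smt (verit) mult.assoc power_Suc2)
  qed
  from this[of m] m obtain h where h: "\<And>z. norm z < 1 \<Longrightarrow> f z = z ^ m * h z \<and> norm (h z) \<le> 1" by auto
  have "norm (f z) = norm z ^ m * norm (h z)" using h[OF z] by (simp add: norm_mult norm_power)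
  also have "\<dots> \<le> norm z ^ m * 1" using h[OF z] by (intro mult_left_mono) auto
  finally show ?thesis by simp
qed

section \<open>Roots of unity: averages of logarithms and products of differences\<close>

definition unity_root :: "nat \<Rightarrow> complex" where
  "unity_root m = cis (2 * pi / real m)"

lemma norm_unity_root [simp]: "norm (unity_root m) = 1"
  by (simp add: unity_root_def)

lemma unity_root_power: "unity_root m ^ k = cis (2 * pi * real k / real m)"
  by (simp add: unity_root_def Complex.DeMoivre mult_ac)

lemma unity_root_power_self: "m > 0 \<Longrightarrow> unity_root m ^ m = 1"
  by (simp add: unity_root_power)

lemma bij_betw_unity_root_powers:
  "m > 0 \<Longrightarrow> bij_betw (\<lambda>k. unity_root m ^ k) {..<m} {z. z ^ m = 1}"
  unfolding unity_root_power using Complex.bij_betw_roots_unity .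

lemma unity_root_power_neq_1:
  assumes "0 < k" "k < m" shows "unity_root m ^ k \<noteq> 1"
proof
  assume "unity_root m ^ k = 1"
  moreover have "inj_on (\<lambda>k. unity_root m ^ k) {..<m}"
    using bij_betw_unity_root_powers[of m] assms by (simp add: bij_betw_def)
  ultimately have "k = 0" using assms by (auto dest!: inj_onD[of _ _ k 0])
  thus False using assms by simp
qed

text \<open>Averaging \<open>log f\<close> over the rotations by \<open>m\<close>-th roots of unity leaves only the Taylor
  coefficients of index divisible by \<open>m\<close>, so the average is within \<open>O(q ^ m)\<close> of the value at 0.\<close>

lemma sum_ln_norm_rotations_le:
  fixes f :: "complex \<Rightarrow> complex"
  assumes hol: "f holomorphic_on ball 0 r" and nz: "\<And>z. norm z < r \<Longrightarrow> f z \<noteq> 0"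
    and bound: "\<And>z. norm z < r \<Longrightarrow> ln (norm (f z)) \<le> A"
    and B: "A - ln (norm (f 0)) \<le> B" "B > 0"
    and m: "m > 0" and q: "0 < q" "q < 1" and r: "r > 0"
  shows "(\<Sum>j<m. ln (norm (f (of_real (q * r) * unity_root m ^ j))))
           \<le> real m * (ln (norm (f 0)) + 2 * B * q ^ m / (1 - q ^ m))"
proof -
  define w where "w = unity_root m"
  have w [simp]: "norm w = 1" "w ^ m = 1" "\<And>z. norm (w * z) = norm z" "\<And>z j. norm (w ^ j * z) = norm z" "w \<noteq> 0"
    using m unity_root_power_self by (auto simp: w_def norm_mult norm_power) (metis norm_unity_root norm_zero zero_neq_one)
  define F where "F = (\<lambda>z. f (of_real r * z))"
  have F: "F holomorphic_on ball 0 1"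
    unfolding F_def using r
    by (intro holomorphic_on_compose_gen[OF _ hol, unfolded o_def] holomorphic_intros)
       (auto simp: norm_mult)
  have Fnz: "F z \<noteq> 0" and FA: "ln (norm (F z)) \<le> A" if "norm z < 1" for z
    using r that by (auto simp: F_def norm_mult intro!: nz bound)
  obtain g where g: "g holomorphic_on ball 0 1" "\<And>z. z \<in> ball 0 1 \<Longrightarrow> F z = exp (g z)"
    using contractible_imp_holomorphic_log[OF F convex_imp_contractible[OF convex_ball]] Fnz by auto
  have Reg: "Re (g z) = ln (norm (F z))" if "norm z < 1" for z
    using g(2)[of z] that by simp
  \<comment> \<open>Subtracting the value at 0 gives \<open>h 0 = 0\<close>, the normalization
    required by the Schwarz lemma.\<close>
  define h where "h = (\<lambda>z. (\<Sum>j<m. g (w ^ j * z)) / of_nat m - g 0)"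
  have hhol: "h holomorphic_on ball 0 1" unfolding h_def using m
    by (intro holomorphic_intros holomorphic_on_compose_gen[OF _ g(1), unfolded o_def]) auto
  have Reh: "Re (h z) = (\<Sum>j<m. ln (norm (F (w ^ j * z)))) / real m - ln (norm (F 0))" if "norm z < 1" for z
    using Reg that by (simp add: h_def)
  have RehB: "Re (h z) \<le> B" if "norm z < 1" for z
  proof -
    have "(\<Sum>j<m. ln (norm (F (w ^ j * z)))) \<le> (\<Sum>j<m. A)"
      using that by (intro sum_mono FA) auto
    hence "(\<Sum>j<m. ln (norm (F (w ^ j * z)))) / real m \<le> A" using m by (simp add: field_simps)
    thus ?thesis using B Reh[OF that] by (simp add: F_def)
  qed
  have h0: "h 0 = 0" using m by (simp add: h_def)
  have hinv: "h (w * z) = h z" for z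
  proof -
    \<comment> \<open>The shift of the index trades the term of index 0 for that of index m, and
      these agree because \<open>w ^ m = 1\<close>.\<close>
    have "(\<Sum>j<m. g (w ^ j * (w * z))) + g (w ^ 0 * z) = (\<Sum>j<Suc m. g (w ^ j * z))"
      unfolding sum.lessThan_Suc_shift by (simp add: mult_ac)
    also have "\<dots> = (\<Sum>j<m. g (w ^ j * z)) + g (w ^ 0 * z)" by simp
    finally show ?thesis by (simp add: h_def)
  qed
  \<comment> \<open>The Moebius map u / (2 B - u) fixes 0 and sends the half plane Re u \<le> B into
    the closed unit disk, as in the Borel-Caratheodory inequality.\<close>
  define p where "p = (\<lambda>z. h z / (2 * of_real B - h z))"
  have nz2: "2 * of_real B - h z \<noteq> 0" if "norm z < 1" for z
    using RehB[OF that] B(2) by (auto simp: complex_eq_iff)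
  have phol: "p holomorphic_on ball 0 1" unfolding p_def
    by (intro holomorphic_intros hhol) (use nz2 in auto)
  have ple: "norm (p z) \<le> 1" if "norm z < 1" for z
  proof -
    have "(Re (h z))\<^sup>2 \<le> (2 * B - Re (h z))\<^sup>2"
      using mult_nonneg_nonneg[of B "B - Re (h z)"] RehB[OF that] B(2) by (simp add: power2_eq_square algebra_simps)
    hence "norm (h z) \<le> norm (2 * of_real B - h z)"
      by (simp add: cmod_def)
    thus ?thesis using nz2[OF that] by (simp add: p_def norm_divide divide_le_eq)
  qed
  have pm: "norm (p (of_real q)) \<le> q ^ m"
    using Schwarz_rotation_invariant[OF phol _ ple, of w m "of_real q"] m q h0 hinv
          unity_root_power_neq_1[of _ m]
    by (simp add: p_def w_def)
  have qm: "q ^ m < 1" using q m by (simp add: power_Suc_less_one power_less_one_iff)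
  define x where "x = p (of_real q)"
  have nx: "1 + x \<noteq> 0"
  proof
    assume "1 + x = 0"
    hence "x = -1" by (simp add: add_eq_0_iff)
    thus False using pm qm by (simp add: x_def)
  qed
  \<comment> \<open>Inverting the Moebius map turns the bound \<open>q ^ m\<close> for
    \<open>x\<close> into one for \<open>h q\<close>.\<close>
  have "h q = x * (2 * of_real B - h q)"
    using nz2[of q] q by (simp add: x_def p_def)
  hence hx: "h q = 2 * of_real B * x / (1 + x)" using nx by (simp add: field_simps)
  have "norm (1 + x) \<ge> 1 - q ^ m"
    using norm_triangle_ineq2[of 1 "-x"] pm by (simp add: x_def)
  hence "norm (h q) \<le> 2 * B * q ^ m / (1 - q ^ m)"
    unfolding hx norm_divide norm_mult using pm B(2) qm
    using q by (intro frac_le mult_mono) (auto simp: x_def)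
  hence "Re (h q) \<le> 2 * B * q ^ m / (1 - q ^ m)"
    using complex_Re_le_cmod order_trans by blast
  hence "(\<Sum>j<m. ln (norm (F (w ^ j * q)))) / real m \<le> ln (norm (F 0)) + 2 * B * q ^ m / (1 - q ^ m)"
    using Reh[of q] q by simp
  hence "(\<Sum>j<m. ln (norm (F (w ^ j * q)))) \<le> real m * (ln (norm (F 0)) + 2 * B * q ^ m / (1 - q ^ m))"
    using m by (simp add: field_simps)
  thus ?thesis by (simp add: F_def w_def mult_ac)
qed

text \<open>The product is the modulus of the derivative of \<open>X ^ m - 1\<close> at one of its roots.\<close>

lemma prod_norm_unity_root_diffs:
  assumes "j < m"
  shows "(\<Prod>i\<in>{..<m}-{j}. norm (unity_root m ^ j - unity_root m ^ i)) = real m"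
proof -
  define w where "w = unity_root m"
  have m: "m > 0" using assms by simp
  have bij: "bij_betw (\<lambda>k. w ^ k) {..<m} {z. z ^ m = 1}"
    using bij_betw_unity_root_powers m by (simp add: w_def)
  define P :: "complex poly" where "P = (\<Prod>i<m. [:- (w ^ i), 1:])"
  have P: "P = monom 1 m - 1"
  proof -
    \<comment> \<open>Both polynomials are monic of degree m, so their difference has degree below
      m, yet it vanishes at all m roots of unity.\<close>
    have "degree (monom 1 m - 1 - P) < m"
    proof -
      have dP: "degree P = m" "lead_coeff P = 1"
        unfolding P_def by (subst degree_prod_eq_sum_degree; simp) (simp add: lead_coeff_prod)
      have "coeff (monom 1 m - 1 - P) n = 0" if "n \<ge> m" for n
        using dP that m coeff_eq_0[of P n] by (cases "n = m") auto
      hence "degree (monom 1 m - 1 - P) \<le> m - 1" using m by (intro degree_le) (metis Suc_diff_1 Suc_leI)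
      thus ?thesis using m by linarith
    qed
    moreover have "poly (monom 1 m - 1 - P) z = 0" if "z ^ m = 1" for z
    proof -
      have "z \<in> (\<lambda>k. w ^ k) ` {..<m}" using bij_betw_imp_surj_on[OF bij] that by blast
      then obtain k where "k < m" "z = w ^ k" by blast
      hence "poly P z = 0" by (auto simp: P_def poly_prod)
      thus ?thesis using that by (simp add: poly_monom)
    qed
    ultimately have "monom 1 m - 1 - P = 0"
      using m by (intro poly_eqI_degree[of "{z. z ^ m = 1}"]) (auto simp: card_roots_unity_eq)
    thus ?thesis by simp
  qed
  have "P = [:- (w ^ j), 1:] * (\<Prod>i\<in>{..<m}-{j}. [:- (w ^ i), 1:])"
    unfolding P_def using assms by (subst prod.remove[of _ j]) auto
  hence "poly (pderiv P) (w ^ j) = (\<Prod>i\<in>{..<m}-{j}. w ^ j - w ^ i)"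
    by (simp add: pderiv_mult pderiv_pCons poly_prod del: mult_pCons_left)
  moreover have "poly (pderiv P) (w ^ j) = of_nat m * (w ^ j) ^ (m - 1)"
    by (simp add: P pderiv_diff pderiv_monom poly_monom)
  ultimately have "norm (\<Prod>i\<in>{..<m}-{j}. w ^ j - w ^ i) = real m"
    by (simp add: norm_mult norm_power w_def)
  thus ?thesis by (simp add: prod_norm w_def)
qed

text \<open>The square of this Vandermonde product runs over all ordered pairs of distinct indices,
  so it equals m^m by \<open>prod_norm_unity_root_diffs\<close>.\<close>

lemma prod_norm_unity_root_diffs_ge_1:
  "(\<Prod>j<m. \<Prod>i<j. norm (unity_root m ^ j - unity_root m ^ i)) \<ge> 1"
proof -
  define d where "d = (\<lambda>j i. norm (unity_root m ^ j - unity_root m ^ i))"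
  have sym: "d i j = d j i" for i j by (simp add: d_def norm_minus_commute)
  define Q where "Q = (\<Prod>j<m. \<Prod>i<j. d j i)"
  have Q0: "Q \<ge> 0" unfolding Q_def by (intro prod_nonneg) (auto simp: d_def)
  have split: "{..<m} - {j} = {..<j} \<union> {j<..<m}" if "j < m" for j using that by auto
  have "(\<Prod>j<m. \<Prod>i\<in>{..<m}-{j}. d j i) = (\<Prod>j<m. (\<Prod>i<j. d j i) * (\<Prod>i\<in>{j<..<m}. d j i))"
    by (intro prod.cong refl) (simp add: split, subst prod.union_disjoint, auto)
  also have "\<dots> = Q * (\<Prod>j<m. \<Prod>i\<in>{j<..<m}. d j i)"
    by (simp add: prod.distrib Q_def)
  also have "(\<Prod>j<m. \<Prod>i\<in>{j<..<m}. d j i) = (\<Prod>(j,i)\<in>Sigma {..<m} (\<lambda>j. {j<..<m}). d j i)"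
    by (subst prod.Sigma) auto
  also have "\<dots> = (\<Prod>(i,j)\<in>Sigma {..<m} (\<lambda>j. {..<j}). d j i)"
    by (rule prod.reindex_bij_witness[of _ prod.swap prod.swap]) auto
  also have "\<dots> = Q" unfolding Q_def by (subst prod.Sigma) (auto simp: sym intro!: prod.cong)
  finally have "Q * Q = (\<Prod>j<m. real m)"
    using prod_norm_unity_root_diffs by (simp add: d_def)
  also have "\<dots> \<ge> 1"
    by (cases "m = 0") (auto)
  finally have "Q * Q \<ge> 1" .
  moreover have "Q * Q \<le> Q" if "Q < 1" using mult_left_mono[of Q 1 Q] Q0 that by simp
  ultimately have "Q \<ge> 1" by linarith
  thus ?thesis by (simp add: Q_def d_def)
qed

section \<open>Change of variables for Vandermonde matrices\<close>

lemma nn_integral_lborel_affine: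
  fixes c :: real and t :: complex and f :: "complex \<Rightarrow> ennreal"
  assumes c: "c > 0" and [measurable]: "f \<in> borel_measurable borel"
  shows "(\<integral>\<^sup>+x. f (t + of_real c * x) \<partial>lborel) = ennreal (1 / c\<^sup>2) * (\<integral>\<^sup>+x. f x \<partial>lborel)"
proof -
  have "(\<integral>\<^sup>+x. f x \<partial>lborel) = (\<integral>\<^sup>+x. f x \<partial>density (distr lborel borel (\<lambda>x. t + c *\<^sub>R x)) (\<lambda>_. \<bar>c\<bar>^DIM(complex)))"
    using lborel_affine[of c t] c by simp
  also have "\<dots> = ennreal (c\<^sup>2) * (\<integral>\<^sup>+x. f (t + of_real c * x) \<partial>lborel)"
    using c by (subst nn_integral_density) (auto simp: nn_integral_distr nn_integral_cmult scaleR_conv_of_real)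
  finally have "ennreal (1 / c\<^sup>2) * (\<integral>\<^sup>+x. f x \<partial>lborel)
     = (ennreal (1 / c\<^sup>2) * ennreal (c\<^sup>2)) * (\<integral>\<^sup>+x. f (t + of_real c * x) \<partial>lborel)"
    by (simp add: mult.assoc)
  also have "ennreal (1 / c\<^sup>2) * ennreal (c\<^sup>2) = 1"
    using c by (simp flip: ennreal_mult)
  finally show ?thesis by simp
qed

text \<open>The rotation part of the multiplication by d can be pulled out of the norm, which leaves
  a positive real scaling and a new shift.\<close>

lemma nn_integral_lborel_radial_affine:
  fixes d t :: complex and f :: "real \<Rightarrow> ennreal"
  assumes d: "d \<noteq> 0" and [measurable]: "f \<in> borel_measurable borel"
  shows "(\<integral>\<^sup>+x. f (norm (t + d * x)) \<partial>lborel) = ennreal (1 / (norm d)\<^sup>2) * (\<integral>\<^sup>+x. f (norm (x::complex)) \<partial>lborel)"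
proof -
  have "norm (t + d * x) = norm (of_real (norm d) * (t / d) + of_real (norm d) * x)" for x
  proof -
    have "t + d * x = d * (t / d + x)" using d by (simp add: distrib_left)
    hence "norm (t + d * x) = norm (d * (t / d + x))" by simp
    also have "\<dots> = norm (of_real (norm d) * (t / d + x))" by (simp add: norm_mult)
    finally show ?thesis by (simp add: algebra_simps)
  qed
  thus ?thesis
    using nn_integral_lborel_affine[of "norm d" "\<lambda>x. f (norm x)" "of_real (norm d) * (t / d)"] d by simp
qed

text \<open>For the Newton step: divided differences keep the leading coefficients
  \<open>c k\<close>.\<close>

lemma coeff_synthetic_div_degree:
  fixes p :: "'a::comm_ring_1 poly"
  assumes "degree p = Suc n"
  shows "coeff (synthetic_div p c) n = coeff p (Suc n)"
proof -
  have "coeff (p + smult c (synthetic_div p c)) (Suc n) = coeff (pCons (poly p c) (synthetic_div p c)) (Suc n)"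
    by (simp only: synthetic_div_correct)
  moreover have "coeff (synthetic_div p c) (Suc n) = 0"
    using assms by (intro coeff_eq_0) (simp add: degree_synthetic_div)
  ultimately show ?thesis by simp
qed

lemma poly_eq_synthetic_div:
  fixes p :: "'a::comm_ring_1 poly"
  shows "poly p z = poly p c + (z - c) * poly (synthetic_div p c) z"
proof -
  have "poly p z = poly ([:-c, 1:] * synthetic_div p c + [:poly p c:]) z"
    by (simp only: synthetic_div_correct')
  thus ?thesis by (simp add: algebra_simps)
qed

text \<open>A change of variables for the Vandermonde matrix, by Newton interpolation: integrating out the
  coefficient of the constant polynomial replaces it by the value at the last node, and the
  remaining polynomials by their divided differences at that node. Only radial functions
  occur, so that no rotation invariance of the Lebesgue measure is needed.\<close>

lemma vandermonde_nn_integral_le: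
  fixes z :: "nat \<Rightarrow> complex" and \<psi> :: "real \<Rightarrow> ennreal" and \<mu> :: "complex measure"
  assumes sf: "sigma_finite_measure \<mu>" and [measurable_cong]: "sets \<mu> = sets borel"
    and \<mu>: "\<And>f. f \<in> borel_measurable borel \<Longrightarrow> (\<integral>\<^sup>+x. f x \<partial>\<mu>) \<le> C * (\<integral>\<^sup>+x. f x \<partial>lborel)"
    and \<psi> [measurable]: "\<psi> \<in> borel_measurable borel"
    and z: "\<And>i j. i < m \<Longrightarrow> j < i \<Longrightarrow> z i \<noteq> z j"
    and P: "\<And>k. l \<le> k \<Longrightarrow> k < l + m \<Longrightarrow> degree (P k) = k - l"
    and c: "\<And>k. l \<le> k \<Longrightarrow> k < l + m \<Longrightarrow> c k > 0 \<and> coeff (P k) (k - l) = of_real (c k)"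
    and d: "\<And>j. j < m \<Longrightarrow> d j \<noteq> 0"
  shows "(\<integral>\<^sup>+x. (\<Prod>j<m. \<psi> (norm (t j + d j * (\<Sum>k=l..<l+m. x k * poly (P k) (z j))))) \<partial>(PiM {l..<l+m} (\<lambda>_. \<mu>)))
    \<le> (C * (\<integral>\<^sup>+x. \<psi> (norm (x::complex)) \<partial>lborel)) ^ m
       * ennreal (1 / (\<Prod>k=l..<l+m. c k)\<^sup>2 / (\<Prod>j<m. norm (d j))\<^sup>2 / (\<Prod>j<m. \<Prod>i<j. norm (z j - z i))\<^sup>2)"
  using z P c d
\<comment> \<open>One Newton step moves the starting index, shifts every value and multiplies it by
  a node difference, so \<open>l\<close>, \<open>t\<close> and \<open>d\<close> have to
  vary.\<close>
proof (induction m arbitrary: l P c t d)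
  case 0
  interpret sigma_finite_measure \<mu> by fact
  show ?case by (simp add: PiM_empty nn_integral_count_space_finite)
next
  case (Suc m)
  interpret sigma_finite_measure \<mu> by fact
  interpret product_sigma_finite "\<lambda>_::nat. \<mu>" by standard
  define I where "I = (\<integral>\<^sup>+x. \<psi> (norm (x::complex)) \<partial>lborel)"
  define K where "K = {Suc l..<Suc l + m}"
  have K: "{l..<l + Suc m} = insert l K" "finite K" "l \<notin> K" by (auto simp: K_def)
  define Q where "Q k = synthetic_div (P k) (z m)" for k
  have Pl: "poly (P l) w = of_real (c l)" for w
    using Suc.prems(2)[of l] Suc.prems(3)[of l] by (auto elim!: degree_eq_zeroE)
  have cl: "c l > 0" using Suc.prems(3)[of l] by simp
  have degQ: "degree (Q k) = k - Suc l" "c k > 0" "coeff (Q k) (k - Suc l) = of_real (c k)" if "Suc l \<le> k" "k < Suc l + m" for k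
  proof -
    have "degree (P k) = Suc (k - Suc l)" using Suc.prems(2)[of k] that by simp
    from coeff_synthetic_div_degree[OF this] this show "degree (Q k) = k - Suc l" "c k > 0" "coeff (Q k) (k - Suc l) = of_real (c k)"
      using Suc.prems(3)[of k] that by (simp_all add: Q_def degree_synthetic_div Suc_diff_Suc)
  qed
  have dm: "d m \<noteq> 0" using Suc.prems(4) by simp
  \<comment> \<open>The factor from the divided difference at the node \<open>z m\<close> is
    absorbed into \<open>d\<close>.\<close>
  define d' where "d' j = d j * (z j - z m)" for j
  have d': "d' j \<noteq> 0" if "j < m" for j
    using Suc.prems(1)[of m j] Suc.prems(4)[of j] that by (auto simp: d'_def)
  define G where "G y x = \<psi> (norm (t m + d m * y)) * (\<Prod>j<m. \<psi> (norm ((t j + d j * y) + d' j * (\<Sum>k\<in>K. x k * poly (Q k) (z j)))))" for y x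
  have [measurable]: "(\<lambda>(y, x). G y x) \<in> borel_measurable (borel \<Otimes>\<^sub>M PiM K (\<lambda>_. \<mu>))"
    unfolding G_def by measurable
  have [measurable]: "(\<lambda>y. G y x) \<in> borel_measurable borel" for x
    unfolding G_def by measurable
  have [measurable]: "(\<lambda>x. G y x) \<in> borel_measurable (PiM K (\<lambda>_. \<mu>))" for y
    unfolding G_def by measurable
  define H where "H x = (\<Prod>j<Suc m. \<psi> (norm (t j + d j * (\<Sum>k=l..<l+Suc m. x k * poly (P k) (z j)))))" for x
  have [measurable]: "H \<in> borel_measurable (PiM (insert l K) (\<lambda>_. \<mu>))"
    unfolding H_def K(1) by measurable
  \<comment> \<open>As \<open>P l\<close> is constant, the value at \<open>z m\<close> is affine in
    y, and the value at any other node differs from it by \<open>z j - z m\<close> times the divided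
    differences.\<close>
  have HG: "H (x(l := y)) = G ((\<Sum>k\<in>K. x k * poly (P k) (z m)) + of_real (c l) * y) x" for x y
  proof -
    define R where "R = (\<Sum>k\<in>K. x k * poly (P k) (z m)) + of_real (c l) * y"
    have *: "(\<Sum>k=l..<l+Suc m. (x(l := y)) k * poly (P k) w) = R + (w - z m) * (\<Sum>k\<in>K. x k * poly (Q k) w)" for w
    proof -
      have "(\<Sum>k=l..<l+Suc m. (x(l := y)) k * poly (P k) w) = of_real (c l) * y + (\<Sum>k\<in>K. (x(l := y)) k * poly (P k) w)"
        unfolding K(1) using K(2,3) by (simp add: Pl)
      also have "(\<Sum>k\<in>K. (x(l := y)) k * poly (P k) w) = (\<Sum>k\<in>K. x k * (poly (P k) (z m) + (w - z m) * poly (Q k) w))"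
        using K(3) poly_eq_synthetic_div[of "P _" w "z m"] by (intro sum.cong refl) (auto simp: Q_def)
      finally show ?thesis by (simp add: R_def sum.distrib sum_distrib_left algebra_simps sum_subtractf del: sum.op_ivl_Suc)
    qed
    show ?thesis unfolding H_def * R_def[symmetric] G_def
      by (simp add: d'_def algebra_simps)
  qed
  have sfl: "sigma_finite_measure (PiM K (\<lambda>_. \<mu>))"
    by (rule sigma_finite) (simp add: K(2))
  interpret pair: pair_sigma_finite "PiM K (\<lambda>_. \<mu>)" "lborel :: complex measure"
    using sfl by (simp add: pair_sigma_finite_def lborel.sigma_finite_measure_axioms)
  have "(\<integral>\<^sup>+x. H x \<partial>PiM {l..<l + Suc m} (\<lambda>_. \<mu>)) = (\<integral>\<^sup>+x. (\<integral>\<^sup>+y. H (x(l := y)) \<partial>\<mu>) \<partial>PiM K (\<lambda>_. \<mu>))"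
    unfolding K(1) by (rule product_nn_integral_insert) (use K in auto)
  \<comment> \<open>In the coordinate l, \<mu> is replaced by C times Lebesgue measure, and the
    value at \<open>z m\<close> becomes the new variable.\<close>
  also have "\<dots> \<le> (\<integral>\<^sup>+x. C * (ennreal (1 / (c l)\<^sup>2) * (\<integral>\<^sup>+y. G y x \<partial>lborel)) \<partial>PiM K (\<lambda>_. \<mu>))"
  proof (intro nn_integral_mono)
    fix x
    have "(\<integral>\<^sup>+y. H (x(l := y)) \<partial>\<mu>) \<le> C * (\<integral>\<^sup>+y. H (x(l := y)) \<partial>lborel)"
      unfolding HG by (intro \<mu>) measurable
    also have "(\<integral>\<^sup>+y. H (x(l := y)) \<partial>lborel) = ennreal (1 / (c l)\<^sup>2) * (\<integral>\<^sup>+y. G y x \<partial>lborel)"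
      unfolding HG by (rule nn_integral_lborel_affine) (use cl in auto)
    finally show "(\<integral>\<^sup>+y. H (x(l := y)) \<partial>\<mu>) \<le> C * (ennreal (1 / (c l)\<^sup>2) * (\<integral>\<^sup>+y. G y x \<partial>lborel))" .
  qed
  also have "\<dots> = C * ennreal (1 / (c l)\<^sup>2) * (\<integral>\<^sup>+x. \<integral>\<^sup>+y. G y x \<partial>lborel \<partial>PiM K (\<lambda>_. \<mu>))"
    by (simp add: mult.assoc nn_integral_cmult)
  \<comment> \<open>With the order exchanged, the value y at the last node is fixed while the other
    coordinates are integrated. The induction hypothesis applies uniformly in y because its bound is
    independent of the shifts.\<close>
  also have "(\<integral>\<^sup>+x. \<integral>\<^sup>+y. G y x \<partial>lborel \<partial>PiM K (\<lambda>_. \<mu>)) = (\<integral>\<^sup>+y. \<integral>\<^sup>+x. G y x \<partial>PiM K (\<lambda>_. \<mu>) \<partial>lborel)"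
    by (rule pair.Fubini'[symmetric]) measurable
  also have "\<dots> \<le> (\<integral>\<^sup>+y. \<psi> (norm (t m + d m * y)) * ((C * I) ^ m
       * ennreal (1 / (\<Prod>k\<in>K. c k)\<^sup>2 / (\<Prod>j<m. norm (d' j))\<^sup>2 / (\<Prod>j<m. \<Prod>i<j. norm (z j - z i))\<^sup>2)) \<partial>lborel)"
  proof (intro nn_integral_mono)
    fix y
    have "(\<integral>\<^sup>+x. G y x \<partial>PiM K (\<lambda>_. \<mu>)) = \<psi> (norm (t m + d m * y)) *
       (\<integral>\<^sup>+x. (\<Prod>j<m. \<psi> (norm ((t j + d j * y) + d' j * (\<Sum>k=Suc l..<Suc l+m. x k * poly (Q k) (z j))))) \<partial>PiM {Suc l..<Suc l+m} (\<lambda>_. \<mu>))"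
      unfolding G_def K_def by (rule nn_integral_cmult) measurable
    also have "\<dots> \<le> \<psi> (norm (t m + d m * y)) * ((C * I) ^ m
       * ennreal (1 / (\<Prod>k\<in>K. c k)\<^sup>2 / (\<Prod>j<m. norm (d' j))\<^sup>2 / (\<Prod>j<m. \<Prod>i<j. norm (z j - z i))\<^sup>2))"
      unfolding I_def K_def
      by (intro mult_left_mono Suc.IH) (use Suc.prems(1) degQ d' in auto)
    finally show "(\<integral>\<^sup>+x. G y x \<partial>PiM K (\<lambda>_. \<mu>)) \<le> \<dots>" .
  qed
  also have "\<dots> = ennreal (1 / (norm (d m))\<^sup>2) * I * ((C * I) ^ m
       * ennreal (1 / (\<Prod>k\<in>K. c k)\<^sup>2 / (\<Prod>j<m. norm (d' j))\<^sup>2 / (\<Prod>j<m. \<Prod>i<j. norm (z j - z i))\<^sup>2))"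
    unfolding I_def by (subst nn_integral_multc) (use dm in \<open>auto simp: nn_integral_lborel_radial_affine\<close>)
  also have "C * ennreal (1 / (c l)\<^sup>2) * \<dots> = (C * I) ^ Suc m * (ennreal (1 / (c l)\<^sup>2) * (ennreal (1 / (norm (d m))\<^sup>2)
       * ennreal (1 / (\<Prod>k\<in>K. c k)\<^sup>2 / (\<Prod>j<m. norm (d' j))\<^sup>2 / (\<Prod>j<m. \<Prod>i<j. norm (z j - z i))\<^sup>2)))"
    by (simp add: mult_ac)
  \<comment> \<open>The factors \<open>norm (z j - z m)\<close> contained in \<open>d'\<close>
    complete the Vandermonde product.\<close>
  also have "ennreal (1 / (c l)\<^sup>2) * (ennreal (1 / (norm (d m))\<^sup>2)
       * ennreal (1 / (\<Prod>k\<in>K. c k)\<^sup>2 / (\<Prod>j<m. norm (d' j))\<^sup>2 / (\<Prod>j<m. \<Prod>i<j. norm (z j - z i))\<^sup>2))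
      = ennreal (1 / (\<Prod>k=l..<l+Suc m. c k)\<^sup>2 / (\<Prod>j<Suc m. norm (d j))\<^sup>2 / (\<Prod>j<Suc m. \<Prod>i<j. norm (z j - z i))\<^sup>2)"
  proof -
    have *: "ennreal (1 / A\<^sup>2) * (ennreal (1 / B\<^sup>2) * ennreal (1 / X\<^sup>2 / (Y * V)\<^sup>2 / W\<^sup>2))
        = ennreal (1 / (A * X)\<^sup>2 / (Y * B)\<^sup>2 / (W * V)\<^sup>2)" for A B X Y V W :: real
      by (simp flip: ennreal_mult) (simp add: power_mult_distrib mult_ac)
    have prodK: "(\<Prod>k=l..<l+Suc m. c k) = c l * (\<Prod>k\<in>K. c k)"
      unfolding K(1) using K(2,3) by simp
    show ?thesis unfolding prodK
      using *[of "c l" "norm (d m)" "\<Prod>k\<in>K. c k" "\<Prod>j<m. norm (d j)" "\<Prod>j<m. norm (z j - z m)" "\<Prod>j<m. \<Prod>i<j. norm (z j - z i)"] K(2,3)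
      by (simp add: d'_def norm_mult prod.distrib norm_minus_commute[of "z m"])
  qed
  finally show ?case by (simp add: H_def I_def mult_left_mono)
qed

section \<open>Log-concave weights and exceptional sets\<close>

lemma emeasure_log_measure_Icc:
  fixes u v :: real
  assumes "0 < u" "u \<le> v"
  shows "emeasure (density lebesgue (\<lambda>t. ennreal (1 / t))) {u..v} = ennreal (ln v - ln u)"
proof -
  have "emeasure (density lebesgue (\<lambda>t. ennreal (1 / t))) {u..v} = (\<integral>\<^sup>+t. ennreal (1 / t) * indicator {u..v} t \<partial>lborel)"
    by (subst emeasure_density) (auto simp: nn_integral_completion intro!: measurable_completion)
  also have "\<dots> = ennreal (ln v - ln u)"
    by (rule nn_integral_FTC_Icc) (use assms in \<open>auto intro!: derivative_eq_intros\<close>)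
  finally show ?thesis .
qed

text \<open>A Borel type growth lemma: on each dyadic level \<open>2 ^ k \<le> F < 2 ^ (k + 1)\<close> the bad set has
  logarithmic diameter at most \<open>2 powr (- k * \<epsilon>)\<close>, since \<open>F\<close> grows too fast after its first bad point.\<close>

lemma growth_exceptional_set:
  fixes F D :: "real \<Rightarrow> real"
  assumes R: "R \<ge> 1" and F1: "\<And>r. r \<ge> R \<Longrightarrow> F r \<ge> 1"
    and growth: "\<And>r r'. R \<le> r \<Longrightarrow> r \<le> r' \<Longrightarrow> F r + D r * (ln r' - ln r) \<le> F r'"
    and \<epsilon>: "\<epsilon> > 0"
  obtains E where "finite_log_measure E" "\<And>r. r \<ge> 1 \<Longrightarrow> r \<notin> E \<Longrightarrow> r > R \<and> D r \<le> F r powr (1 + \<epsilon>)"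
proof -
  define \<nu> where "\<nu> = density lebesgue (\<lambda>t::real. ennreal (1 / t))"
  have sets_\<nu>: "sets \<nu> = sets lebesgue" by (simp add: \<nu>_def)
  define B where "B k = {r. r \<ge> R \<and> 2 ^ k \<le> F r \<and> F r < 2 ^ Suc k \<and> D r > F r powr (1 + \<epsilon>)}" for k :: nat
  define \<delta> where "\<delta> k = (2 powr (- \<epsilon>)) ^ k" for k :: nat
  have \<delta>0: "\<delta> k \<ge> 0" for k by (simp add: \<delta>_def)
  \<comment> \<open>From a bad point on, F grows at rate at least 2^(k (1 + \<epsilon>)) in ln r,
    but varies by at most 2^k within the level.\<close>
  have ord: "ln r' - ln r \<le> \<delta> k" if "r \<in> B k" "r' \<in> B k" "r \<le> r'" for r r' k
  proof -
    define x where "x = (2::real) ^ k"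
    have x: "x > 0" by (simp add: x_def)
    have l: "ln r' - ln r \<ge> 0" using that R by (auto simp: B_def)
    have "x powr (1 + \<epsilon>) \<le> F r powr (1 + \<epsilon>)"
      using that \<epsilon> x by (intro powr_mono2) (auto simp: B_def x_def)
    also have "\<dots> \<le> D r" using that by (auto simp: B_def)
    finally have "x powr (1 + \<epsilon>) * (ln r' - ln r) \<le> D r * (ln r' - ln r)"
      using l by (rule mult_right_mono)
    also have "\<dots> \<le> F r' - F r" using growth[of r r'] that by (auto simp: B_def)
    also have "\<dots> \<le> x" using that by (auto simp: B_def x_def)
    finally have "ln r' - ln r \<le> x / x powr (1 + \<epsilon>)"
      using x by (simp add: field_simps)
    also have "\<dots> = x powr (- \<epsilon>)" using x by (simp add: powr_add powr_minus field_simps)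
    also have "\<dots> = \<delta> k" by (simp add: x_def \<delta>_def powr_powr powr_realpow[symmetric] mult_ac)
    finally show ?thesis .
  qed
  \<comment> \<open>Measurability of \<open>B k\<close> is not known, so it is covered by an
    interval of logarithmic half-width \<open>\<delta> k\<close> around one of its points.\<close>
  have "\<exists>U. B k \<subseteq> U \<and> U \<in> sets \<nu> \<and> emeasure \<nu> U \<le> ennreal (2 * \<delta> k)" for k
  proof (cases "B k = {}")
    case False
    then obtain r0 where r0: "r0 \<in> B k" by blast
    have r0p: "r0 > 0" using r0 R by (auto simp: B_def)
    show ?thesis
    proof (intro exI[of _ "{r0 * exp (- \<delta> k)..r0 * exp (\<delta> k)}"] conjI subsetI)
      fix r assume r: "r \<in> B k"
      have rp: "r > 0" using r R by (auto simp: B_def)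
      have "ln (r0 * exp (- \<delta> k)) \<le> ln r" "ln r \<le> ln (r0 * exp (\<delta> k))"
        using ord[OF r r0] ord[OF r0 r] \<delta>0[of k] r0p rp linear[of r r0] ln_le_cancel_iff[of r r0] ln_le_cancel_iff[of r0 r]
        by (auto simp: ln_mult simp del: ln_le_cancel_iff)
      thus "r \<in> {r0 * exp (- \<delta> k)..r0 * exp (\<delta> k)}" using r0p rp by simp
    next
      show "emeasure \<nu> {r0 * exp (- \<delta> k)..r0 * exp (\<delta> k)} \<le> ennreal (2 * \<delta> k)"
        unfolding \<nu>_def using r0p \<delta>0[of k] by (subst emeasure_log_measure_Icc) (auto simp: ln_mult)
    qed (simp add: sets_\<nu>)
  qed (auto intro!: exI[of _ "{}"])
  then obtain U where U: "\<And>k. B k \<subseteq> U k" "\<And>k. U k \<in> sets \<nu>" "\<And>k. emeasure \<nu> (U k) \<le> ennreal (2 * \<delta> k)"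
    by metis
  \<comment> \<open>Including \<open>{1..R}\<close> makes the growth hypothesis available at every
    point outside E.\<close>
  define E where "E = {1..R} \<union> ((\<Union>k. U k) \<inter> {1..})"
  have summable: "summable \<delta>"
    unfolding \<delta>_def using \<epsilon> by (intro summable_geometric) (simp add: powr_less_one)
  have "emeasure \<nu> (\<Union>k. U k) \<le> (\<Sum>k. emeasure \<nu> (U k))"
    using U by (intro emeasure_subadditive_countably) auto
  also have "\<dots> \<le> (\<Sum>k. ennreal (2 * \<delta> k))"
    using U by (intro suminf_le) auto
  also have "\<dots> < \<infinity>"
    using summable \<delta>0 by (subst suminf_ennreal2) auto
  finally have "emeasure \<nu> (\<Union>k. U k) < \<infinity>" .
  moreover have "emeasure \<nu> {1..R} < \<infinity>"
    unfolding \<nu>_def using R by (subst emeasure_log_measure_Icc) auto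
  ultimately have "emeasure \<nu> {1..R} + emeasure \<nu> (\<Union>k. U k) < \<infinity>"
    by simp
  moreover have "emeasure \<nu> E \<le> emeasure \<nu> {1..R} + emeasure \<nu> ((\<Union>k. U k) \<inter> {1..})"
    unfolding E_def using U by (intro emeasure_subadditive) (auto simp: sets_\<nu>)
  moreover have "emeasure \<nu> ((\<Union>k. U k) \<inter> {1..}) \<le> emeasure \<nu> (\<Union>k. U k)"
    using U by (intro emeasure_mono) auto
  ultimately have fin: "emeasure \<nu> E < \<infinity>"
    by (meson add_left_mono le_less_trans order_trans)
  have Esets: "E \<in> sets lebesgue"
    unfolding E_def using U by (intro sets.Un sets.Int sets.countable_UN) (auto simp: sets_\<nu>)
  show ?thesis
  proof (rule that[of E])
    show "finite_log_measure E"
      using fin Esets unfolding finite_log_measure_def \<nu>_def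
      by (subst (asm) emeasure_density) (auto intro!: measurable_completion simp: E_def)
  next
    fix r :: real assume r: "r \<ge> 1" "r \<notin> E"
    hence rR: "r > R" by (auto simp: E_def)
    have "D r \<le> F r powr (1 + \<epsilon>)"
    proof (rule ccontr)
      assume bad: "\<not> D r \<le> F r powr (1 + \<epsilon>)"
      define k where "k = nat \<lfloor>log 2 (F r)\<rfloor>"
      have Fr: "F r \<ge> 1" using F1 rR by simp
      have "real k \<le> log 2 (F r)" "log 2 (F r) < real (Suc k)"
        using Fr by (simp_all add: k_def) linarith+
      hence "2 ^ k \<le> F r" "F r < 2 ^ Suc k"
        using Fr by (simp_all only: le_log_iff log_less_iff powr_realpow)
      hence "r \<in> B k" using bad rR by (auto simp: B_def)
      hence "r \<in> E" using U(1)[of k] r by (auto simp: E_def)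
      thus False using r by simp
    qed
    thus "r > R \<and> D r \<le> F r powr (1 + \<epsilon>)" using rR by simp
  qed
qed

section \<open>Concavity of \<open>h\<close> and growth of \<open>S\<close>\<close>

locale log_concave_weights =
  fixes a :: "real \<Rightarrow> real"
  assumes a_pos: "\<And>t. t \<ge> 0 \<Longrightarrow> a t > 0"
    and conc: "concave_on {0..} (\<lambda>t. ln (a t))"
    and lim: "filterlim (\<lambda>t. ln (a t) / t) at_bot at_top"
begin

definition h :: "real \<Rightarrow> nat \<Rightarrow> real" where
  "h r n = ln (a (real n) * r ^ n)"

definition N :: "real \<Rightarrow> nat" where
  "N r = Max (N1 a r)"

text \<open>From this radius on a(1) r \<ge> 1, so the index 1 lies in \<open>N1 a r\<close> and
  \<open>N r\<close> is a genuine maximum.\<close>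

definition R0 :: real where
  "R0 = max 1 (1 / a 1)"

lemma R0_ge_1: "R0 \<ge> 1"
  by (simp add: R0_def)

lemma h_eq: "r > 0 \<Longrightarrow> h r n = ln (a (real n)) + real n * ln r"
  unfolding h_def using a_pos[of "real n"] by (simp add: ln_mult ln_realpow)

lemma exp_h: "r > 0 \<Longrightarrow> exp (h r n) = a (real n) * r ^ n"
  unfolding h_def using a_pos[of "real n"] by simp

lemma N1_iff: "n \<in> N1 a r \<longleftrightarrow> h r n \<ge> 0"
  by (simp add: N1_def h_def)

lemma S_eq: "S a r = 2 * (\<Sum>n\<in>N1 a r. h r n)"
  by (simp add: S_def h_def)

text \<open>Three-point concavity of \<open>ln a\<close> with denominators cleared; the linear term
  n ln r cancels.\<close>

lemma h_concave:
  assumes r: "r > 0" and ijk: "i < j" "j < k"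
  shows "(real k - real j) * h r i + (real j - real i) * h r k \<le> (real k - real i) * h r j"
proof -
  define t where "t = (real j - real i) / (real k - real i)"
  have ki: "real k - real i > 0" using ijk by simp
  have t: "0 \<le> t" "t \<le> 1" "t * (real k - real i) = real j - real i"
    using ijk by (auto simp: t_def field_simps)
  have "(1 - t) * ln (a (real i)) + t * ln (a (real k)) \<le> ln (a ((1 - t) *\<^sub>R real i + t *\<^sub>R real k))"
    using concave_onD[OF conc, of t "real i" "real k"] t by simp
  also have "(1 - t) *\<^sub>R real i + t *\<^sub>R real k = real j"
    using t(3) by (simp add: algebra_simps)
  finally have "(real k - real i) * ((1 - t) * ln (a (real i)) + t * ln (a (real k))) \<le> (real k - real i) * ln (a (real j))"
    using ki by (intro mult_left_mono) auto
  also have "(real k - real i) * ((1 - t) * ln (a (real i)) + t * ln (a (real k)))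
      = ((real k - real i) - t * (real k - real i)) * ln (a (real i)) + (t * (real k - real i)) * ln (a (real k))"
    by (simp add: algebra_simps)
  also have "\<dots> = (real k - real j) * ln (a (real i)) + (real j - real i) * ln (a (real k))"
    unfolding t(3) by simp
  finally show ?thesis using r by (simp add: h_eq algebra_simps)
qed

lemma eventually_h_less:
  assumes "r > 0"
  shows "eventually (\<lambda>n. h r n < c * real n) sequentially"
proof -
  have "filterlim (\<lambda>n. ln (a (real n)) / real n) at_bot sequentially"
    using filterlim_compose[OF lim filterlim_real_sequentially] .
  hence "eventually (\<lambda>n. ln (a (real n)) / real n < c - ln r) sequentially"
    by (simp add: filterlim_at_bot_dense)
  with eventually_gt_at_top[of 0] show ?thesis
  proof eventually_elim
    case (elim n)
    thus ?case using assms by (simp add: h_eq field_simps)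
  qed
qed

lemma finite_N1: "r > 0 \<Longrightarrow> finite (N1 a r)"
proof -
  assume "r > 0"
  then obtain n0 where "\<And>n. n \<ge> n0 \<Longrightarrow> h r n < 0"
    using eventually_h_less[of r 0] by (auto simp: eventually_sequentially)
  hence "N1 a r \<subseteq> {..n0}" by (meson N1_iff atMost_iff nle_le not_le subsetI)
  thus ?thesis by (rule finite_subset) simp
qed

context
  fixes r :: real
  assumes r: "r \<ge> R0"
begin

lemma r_pos: "r > 0" "r \<ge> 1" using r R0_ge_1 by auto

lemma one_in_N1: "1 \<in> N1 a r"
proof -
  have "1 / a 1 \<le> r" using r by (simp add: R0_def)
  hence "1 \<le> a 1 * r" using a_pos[of 1] by (simp add: field_simps)
  thus ?thesis by (simp add: N1_def)
qed

lemma N_in_N1: "N r \<in> N1 a r"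
  unfolding N_def using finite_N1[OF r_pos(1)] one_in_N1 by (intro Max_in) auto

lemma N1_le_N: "n \<in> N1 a r \<Longrightarrow> n \<le> N r"
  unfolding N_def using finite_N1[OF r_pos(1)] by (intro Max_ge) auto

lemma N_ge_1: "N r \<ge> 1"
  using N1_le_N one_in_N1 by blast

lemma h_neg: "n > N r \<Longrightarrow> h r n < 0"
  using N1_le_N[of n] by (force simp: N1_iff)

text \<open>Concavity between the indices 1 and N, both in \<open>N1 a r\<close>. Index 0 is
  excluded since \<open>h r 0 = ln (a 0)\<close> may be negative.\<close>

lemma h_nonneg: "1 \<le> n \<Longrightarrow> n \<le> N r \<Longrightarrow> h r n \<ge> 0"
proof -
  assume n: "1 \<le> n" "n \<le> N r"
  show ?thesis
  proof (cases "n = 1 \<or> n = N r")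
    case True
    thus ?thesis using one_in_N1 N_in_N1 by (auto simp: N1_iff)
  next
    case False
    hence n': "1 < n" "n < N r" using n by auto
    have "0 \<le> (real (N r) - real n) * h r 1 + (real n - real 1) * h r (N r)"
      using n' one_in_N1 N_in_N1 by (intro add_nonneg_nonneg mult_nonneg_nonneg) (auto simp: N1_iff)
    also have "\<dots> \<le> (real (N r) - real 1) * h r n"
      by (rule h_concave) (use n' r_pos in auto)
    finally show ?thesis using n' by (simp add: zero_le_mult_iff)
  qed
qed

lemma N1_bounds: "{1..N r} \<subseteq> N1 a r" "N1 a r \<subseteq> {..N r}"
  using h_nonneg N1_le_N by (auto simp: N1_iff)

lemma h_le_S: "n \<in> N1 a r \<Longrightarrow> h r n \<le> S a r / 2"
  unfolding S_eq using member_le_sum[of n "N1 a r" "h r"] finite_N1[OF r_pos(1)] by (auto simp: N1_iff)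

lemma S_ge_h1: "S a r \<ge> 2 * h r 1"
  using h_le_S[OF one_in_N1] by simp

lemma sum_h_le_S: "2 * (\<Sum>n=1..N r. h r n) \<le> S a r"
  unfolding S_eq using finite_N1[OF r_pos(1)] N1_bounds(1) by (auto intro!: sum_mono2 simp: N1_iff)

text \<open>\<open>N1 a r\<close> is {0..N} or {1..N}. The index 0 is missing exactly when
  \<open>ln (a 0)\<close> is negative, which accounts for the minimum.\<close>

lemma sum_h_ge_S: "S a r + min 0 (2 * ln (a 0)) \<le> 2 * (\<Sum>n<Suc (N r). h r n)"
proof -
  have eq: "(\<Sum>n<Suc (N r). h r n) = h r 0 + (\<Sum>n=1..N r. h r n)"
  proof -
    have "{..<Suc (N r)} = insert 0 {1..N r}" by auto
    thus ?thesis by (simp del: sum.lessThan_Suc)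
  qed
  show ?thesis
  proof (cases "0 \<in> N1 a r")
    case True
    have "N1 a r = insert 0 {1..N r}" using N1_bounds True by fastforce
    thus ?thesis unfolding S_eq eq by simp
  next
    case False
    have "N1 a r = {1..N r}"
    proof
      show "N1 a r \<subseteq> {1..N r}" using N1_bounds(2) False by (auto simp: Suc_le_eq intro: gr0I)
    qed (rule N1_bounds)
    thus ?thesis unfolding S_eq eq by (simp add: h_def)
  qed
qed

text \<open>The maximum M of h is at least S / (2 (N + 1)) and is attained at some n \<le> N. Since
  h is negative at N + 1, concavity through n, N + 1 and N + 1 + k gives a descent of at least M /
  (N + 1) per index.\<close>

lemma h_tail: "h r (Suc (N r) + k) \<le> - real k * S a r / (2 * (real (N r) + 1)\<^sup>2)"
proof (cases "k = 0")
  case True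
  thus ?thesis using h_neg[of "Suc (N r)"] by simp
next
  case False
  define M where "M = Max (h r ` N1 a r)"
  have fin: "finite (N1 a r)" "N1 a r \<noteq> {}" using finite_N1[OF r_pos(1)] one_in_N1 by auto
  have "M \<in> h r ` N1 a r" unfolding M_def using fin by (intro Max_in) auto
  then obtain n where n: "n \<in> N1 a r" "M = h r n" by auto
  have M0: "M \<ge> 0" using n by (simp add: N1_iff)
  have "S a r \<le> 2 * (\<Sum>n\<in>N1 a r. M)"
    unfolding S_eq M_def using fin by (intro mult_left_mono sum_mono) auto
  also have "\<dots> = 2 * (real (card (N1 a r)) * M)" by simp
  also have "\<dots> \<le> 2 * (real (N r + 1) * M)"
    using M0 card_mono[OF _ N1_bounds(2)] by (intro mult_left_mono mult_right_mono) auto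
  finally have SM: "S a r \<le> 2 * (real (N r) + 1) * M" by (simp add: algebra_simps)
  have nN: "n \<le> N r" using N1_le_N n by simp
  have "(real (Suc (N r) + k) - real (Suc (N r))) * h r n + (real (Suc (N r)) - real n) * h r (Suc (N r) + k)
     \<le> (real (Suc (N r) + k) - real n) * h r (Suc (N r))"
    by (rule h_concave) (use r_pos nN False in auto)
  also have "\<dots> \<le> 0" using nN h_neg[of "Suc (N r)"] by (intro mult_nonneg_nonpos) auto
  finally have 1: "real k * M + (real (Suc (N r)) - real n) * h r (Suc (N r) + k) \<le> 0" by (simp add: n)
  \<comment> \<open>Enlarging the factor N + 1 - n to N + 1 is allowed because h is negative
    there.\<close>
  have "(real (N r) + 1) * h r (Suc (N r) + k) \<le> (real (Suc (N r)) - real n) * h r (Suc (N r) + k)"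
    using h_neg[of "Suc (N r) + k"] by (intro mult_right_mono_neg) auto
  also have "\<dots> \<le> - real k * M" using 1 by simp
  finally have "2 * (real (N r) + 1) * ((real (N r) + 1) * h r (Suc (N r) + k)) \<le> 2 * (real (N r) + 1) * (- real k * M)"
    by (intro mult_left_mono) auto
  also have "\<dots> = - real k * (2 * (real (N r) + 1) * M)" by simp
  also have "\<dots> \<le> - real k * S a r" using SM by (intro mult_left_mono_neg) auto
  finally have "h r (Suc (N r) + k) * (2 * (real (N r) + 1)\<^sup>2) \<le> - real k * S a r"
    by (simp add: power2_eq_square algebra_simps)
  moreover have "2 * (real (N r) + 1)\<^sup>2 > 0" by (simp add: add_nonneg_eq_0_iff)
  ultimately show ?thesis using pos_le_divide_eq by blast
qed

end

text \<open>The term of index n gains n (ln r' - ln r), and twice the sum of n over {1..N} is N (N +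
  1). Indices that enter \<open>N1\<close> at the larger radius add nonnegative terms.\<close>

lemma S_growth:
  assumes r: "R0 \<le> r" "r \<le> r'"
  shows "S a r + (real (N r))\<^sup>2 * (ln r' - ln r) \<le> S a r'"
proof -
  have rp: "r > 0" "r' > 0" "R0 \<le> r'" using r R0_ge_1 by auto
  have l: "ln r' - ln r \<ge> 0" using r rp by simp
  have h': "h r' n = h r n + real n * (ln r' - ln r)" for n
    using rp by (simp add: h_eq algebra_simps)
  have sub: "N1 a r \<subseteq> N1 a r'" using l by (auto simp: N1_iff h')
  have "(real (N r))\<^sup>2 \<le> real (N r) * (real (N r) + 1)" by (simp add: power2_eq_square algebra_simps)
  also have "\<dots> = 2 * (\<Sum>n=1..N r. real n)"
    using double_gauss_sum_from_Suc_0[of "N r", where 'a = real] by simp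
  also have "\<dots> \<le> 2 * (\<Sum>n\<in>N1 a r. real n)"
    using finite_N1[OF rp(1)] N1_bounds(1)[OF r(1)] by (intro mult_left_mono sum_mono2) auto
  finally have "(real (N r))\<^sup>2 * (ln r' - ln r) \<le> 2 * (\<Sum>n\<in>N1 a r. real n) * (ln r' - ln r)"
    using l by (intro mult_right_mono)
  moreover have "(\<Sum>n\<in>N1 a r. h r' n) = (\<Sum>n\<in>N1 a r. h r n) + (\<Sum>n\<in>N1 a r. real n) * (ln r' - ln r)"
    unfolding h' sum.distrib sum_distrib_right by simp
  ultimately have "S a r + (real (N r))\<^sup>2 * (ln r' - ln r) \<le> 2 * (\<Sum>n\<in>N1 a r. h r' n)"
    by (simp add: S_eq)
  also have "\<dots> \<le> S a r'" unfolding S_eq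
    using sub finite_N1[OF rp(2)] by (intro mult_left_mono sum_mono2) (auto simp: N1_iff)
  finally show ?thesis .
qed

text \<open>The term of index 1 alone tends to infinity.\<close>

lemma S_at_top: "filterlim (S a) at_top at_top"
proof (rule filterlim_at_top_mono)
  show "filterlim (\<lambda>r. 2 * (ln (a 1) + ln r)) at_top at_top"
    by real_asymp
  show "eventually (\<lambda>r. 2 * (ln (a 1) + ln r) \<le> S a r) at_top"
    using eventually_ge_at_top[of R0]
  proof eventually_elim
    case (elim r)
    thus ?case using S_ge_h1[of r] r_pos[of r] by (simp add: h_eq)
  qed
qed

text \<open>P is a slot for inequalities in S that hold for large S: as S tends to infinity, the
  radii where they fail are bounded and can be absorbed into E.\<close>

lemma exceptional_set:
  assumes \<epsilon>: "\<epsilon> > 0" and P: "eventually P at_top"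
  obtains E where "finite_log_measure E"
    "\<And>r. r \<ge> 1 \<Longrightarrow> r \<notin> E \<Longrightarrow> r \<ge> R0 \<and> (real (N r))\<^sup>2 \<le> S a r powr (1 + \<epsilon>) \<and> P (S a r)"
proof -
  have "eventually (\<lambda>r. P (S a r) \<and> S a r \<ge> 1) at_top"
    using S_at_top P by (intro eventually_conj) (auto simp: filterlim_iff filterlim_at_top)
  then obtain R1 where R1: "\<And>r. r \<ge> R1 \<Longrightarrow> P (S a r) \<and> S a r \<ge> 1"
    by (auto simp: eventually_at_top_linorder)
  define R where "R = max R0 R1"
  show ?thesis
  proof (rule growth_exceptional_set[of R "S a" "\<lambda>r. (real (N r))\<^sup>2" \<epsilon>])
    fix E assume E: "finite_log_measure E"
      "\<And>r. 1 \<le> r \<Longrightarrow> r \<notin> E \<Longrightarrow> R < r \<and> (real (N r))\<^sup>2 \<le> S a r powr (1 + \<epsilon>)"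
    show ?thesis by (rule that[OF E(1)]) (use E(2) R1 in \<open>force simp: R_def\<close>)
  qed (use R0_ge_1 R1 S_growth \<epsilon> in \<open>auto simp: R_def\<close>)
qed

end

section \<open>Power series with linearly bounded coefficients\<close>

lemma sum_linear_geometric_le:
  fixes \<delta> :: real
  assumes \<delta>: "0 < \<delta>" "\<delta> \<le> 1"
  shows "summable (\<lambda>k. (real k + 1) * exp (- real k * \<delta>))"
    and "(\<Sum>k. (real k + 1) * exp (- real k * \<delta>)) \<le> 4 / \<delta>\<^sup>2"
proof -
  define q where "q = exp (- \<delta>)"
  have q: "0 < q" "q < 1" using \<delta> by (auto simp: q_def)
  have eq: "exp (- real k * \<delta>) = q ^ k" for k
    by (simp add: q_def exp_of_nat_mult[symmetric])
  have sums: "(\<lambda>k. (real k + 1) * exp (- real k * \<delta>)) sums (1 / (1 - q)\<^sup>2)"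
    using geometric_deriv_sums[of q] q unfolding eq by (simp add: add.commute)
  thus "summable (\<lambda>k. (real k + 1) * exp (- real k * \<delta>))" by (rule sums_summable)
  \<comment> \<open>This gives 1 - q \<ge> \<delta> / 2, so the sum 1 / (1 - q)^2 is at most 4 /
    \<delta>^2.\<close>
  have "q \<le> 1 / (1 + \<delta>)"
    using exp_ge_add_one_self[of \<delta>] \<delta> by (simp add: q_def exp_minus field_simps)
  also have "\<dots> \<le> 1 - \<delta> / 2"
    using \<delta> mult_nonneg_nonneg[of \<delta> "1 - \<delta>"] by (simp add: field_simps)
  finally have "\<delta> / 2 \<le> 1 - q" by simp
  hence "(\<delta> / 2)\<^sup>2 \<le> (1 - q)\<^sup>2" using \<delta> by (intro power_mono) auto
  hence "1 / (1 - q)\<^sup>2 \<le> 1 / (\<delta> / 2)\<^sup>2" using \<delta> q by (intro frac_le) auto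
  thus "(\<Sum>k. (real k + 1) * exp (- real k * \<delta>)) \<le> 4 / \<delta>\<^sup>2"
    using sums_unique[OF sums] by (simp add: power_divide)
qed

lemma holomorphic_on_power_series:
  fixes c :: "nat \<Rightarrow> complex"
  assumes "conv_radius c = \<infinity>"
  shows "(\<lambda>z. \<Sum>n. c n * z ^ n) holomorphic_on A"
proof -
  have "eval_fps (Abs_fps c) holomorphic_on A"
    using assms by (intro holomorphic_on_eval_fps) (simp add: fps_conv_radius_def eball_inf)
  thus ?thesis by (simp add: eval_fps_def[abs_def])
qed

context log_concave_weights
begin

text \<open>For every R, a(n) R^n is eventually below exp(-n), which beats linear growth of the
  coefficients.\<close>

lemma conv_radius_infinite:
  fixes x :: "nat \<Rightarrow> complex"
  assumes x: "\<And>n. n \<ge> m \<Longrightarrow> norm (x n) \<le> C * (real n + 1)"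
  shows "conv_radius (\<lambda>n. x n * of_real (a (real n))) = \<infinity>"
proof (rule conv_radius_inftyI'')
  fix z :: complex
  define R where "R = norm z + 1"
  have R: "R > 0" "norm z \<le> R" by (auto simp: R_def add_nonneg_pos)
  have C: "C \<ge> 0" using order_trans[OF norm_ge_zero x[of m]] by (simp add: zero_le_mult_iff)
  show "summable (\<lambda>n. x n * of_real (a (real n)) * z ^ n)"
  proof (rule summable_comparison_test_ev)
    show "summable (\<lambda>n. C * ((real n + 1) * exp (- real n * 1)))"
      using sum_linear_geometric_le(1)[of 1] by (intro summable_mult) simp
    show "eventually (\<lambda>n. norm (x n * of_real (a (real n)) * z ^ n) \<le> C * ((real n + 1) * exp (- real n * 1))) sequentially"
      using eventually_h_less[OF R(1), of "-1"] eventually_ge_at_top[of m]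
    proof eventually_elim
      case (elim n)
      have "norm (x n * of_real (a (real n)) * z ^ n) = norm (x n) * (a (real n) * norm z ^ n)"
        using a_pos[of "real n"] by (simp add: norm_mult norm_power)
      also have "\<dots> \<le> norm (x n) * (a (real n) * R ^ n)"
        using a_pos[of "real n"] R by (intro mult_left_mono power_mono) auto
      also have "\<dots> = norm (x n) * exp (h R n)" using exp_h[OF R(1)] by simp
      also have "\<dots> \<le> (C * (real n + 1)) * exp (- real n * 1)"
        using x[OF elim(2)] elim(1) C by (intro mult_mono) auto
      finally show ?case by (simp add: mult_ac)
    qed
  qed
qed

text \<open>Serves both directions: it lets the constant term dominate when a hole is constructed,
  and it bounds the modulus of f when a hole is excluded.\<close>

lemma norm_series_diff_le:
  fixes x :: "nat \<Rightarrow> complex"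
  assumes r: "r \<ge> R0" and \<delta>: "0 < \<delta>" "\<delta> \<le> 1"
    and tail: "\<And>k. h r (Suc (N r) + k) \<le> - real k * \<delta>"
    and x: "\<And>k. norm (x (Suc (N r) + k)) \<le> C * (real k + 1)"
    and z: "norm z \<le> r"
  shows "norm ((\<Sum>n. x n * of_real (a (real n)) * z ^ n) - x 0 * of_real (a 0))
           \<le> (\<Sum>n=1..N r. norm (x n) * exp (h r n)) + C * (4 / \<delta>\<^sup>2)"
proof -
  have C: "C \<ge> 0" using order_trans[OF norm_ge_zero x[of 0]] by simp
  have rp: "r > 0" using r_pos[OF r] by simp
  define u where "u n = x n * of_real (a (real n)) * z ^ n" for n
  have u: "norm (u n) \<le> norm (x n) * exp (h r n)" for n
    unfolding u_def exp_h[OF rp] norm_mult norm_power using a_pos[of "real n"] z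
    by (auto simp: mult.assoc intro!: mult_left_mono power_mono)
  define v where "v k = C * ((real k + 1) * exp (- real k * \<delta>))" for k
  have v: "norm (u (k + Suc (N r))) \<le> v k" for k
  proof -
    have "norm (u (k + Suc (N r))) \<le> norm (x (Suc (N r) + k)) * exp (h r (Suc (N r) + k))"
      using u[of "k + Suc (N r)"] by (simp add: add.commute)
    also have "\<dots> \<le> (C * (real k + 1)) * exp (- real k * \<delta>)"
      using x tail C by (intro mult_mono) auto
    finally show ?thesis by (simp add: v_def mult_ac)
  qed
  have sv: "summable v" unfolding v_def using sum_linear_geometric_le(1)[OF \<delta>] by (rule summable_mult)
  have sn: "summable (\<lambda>k. norm (u (k + Suc (N r))))"
    by (rule summable_comparison_test'[OF sv, of 0]) (use v in auto)
  have "summable (\<lambda>n. u (n + Suc (N r)))" using sn by (rule summable_norm_cancel)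
  hence su: "summable u" by (subst (asm) summable_iff_shift)
  have "suminf u = (\<Sum>k. u (k + Suc (N r))) + (\<Sum>n<Suc (N r). u n)"
    by (rule suminf_split_initial_segment[OF su])
  also have "(\<Sum>n<Suc (N r). u n) = u 0 + (\<Sum>n=1..N r. u n)"
  proof -
    have "{..<Suc (N r)} = insert 0 {1..N r}" by auto
    thus ?thesis by (simp del: sum.lessThan_Suc)
  qed
  finally have "suminf u - u 0 = (\<Sum>k. u (k + Suc (N r))) + (\<Sum>n=1..N r. u n)" by simp
  hence "norm (suminf u - u 0) \<le> norm (\<Sum>k. u (k + Suc (N r))) + norm (\<Sum>n=1..N r. u n)"
    by (simp add: norm_triangle_ineq)
  also have "norm (\<Sum>n=1..N r. u n) \<le> (\<Sum>n=1..N r. norm (x n) * exp (h r n))"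
    using u by (rule sum_norm_le)
  also have "norm (\<Sum>k. u (k + Suc (N r))) \<le> (\<Sum>k. norm (u (k + Suc (N r))))"
    by (rule summable_norm[OF sn])
  also have "\<dots> \<le> (\<Sum>k. v k)" by (rule suminf_le[OF v sn sv])
  also have "\<dots> = C * (\<Sum>k. (real k + 1) * exp (- real k * \<delta>))"
    unfolding v_def by (rule suminf_mult[OF sum_linear_geometric_le(1)[OF \<delta>]])
  also have "\<dots> \<le> C * (4 / \<delta>\<^sup>2)"
    using sum_linear_geometric_le(2)[OF \<delta>] C by (rule mult_left_mono)
  finally show ?thesis by (simp add: u_def add_ac)
qed

end

section \<open>Gaussian coefficients\<close>

definition gauss_density :: "complex \<Rightarrow> ennreal" where
  "gauss_density w = ennreal (exp (- (cmod w)\<^sup>2) / pi)"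

lemma gauss_density_measurable [measurable]: "gauss_density \<in> borel_measurable borel"
  unfolding gauss_density_def by measurable

lemma emeasure_cball_complex: "\<rho> \<ge> 0 \<Longrightarrow> emeasure lborel (cball (c::complex) \<rho>) = ennreal (pi * \<rho>\<^sup>2)"
  by (simp add: emeasure_cball unit_ball_vol_2)

locale gaussian_coefficients = prob_space M
  for M :: "'w measure" and \<phi> :: "nat \<Rightarrow> 'w \<Rightarrow> complex" +
  assumes gaussians: "indep_std_complex_gaussians M \<phi>"
begin

lemma indep: "indep_vars (\<lambda>_. borel) \<phi> UNIV"
  using gaussians by (simp add: indep_std_complex_gaussians_def)

lemma distr_\<phi>: "distr M borel (\<phi> n) = density lborel gauss_density"
proof -
  have "distributed M lborel (\<phi> n) (\<lambda>w. ennreal (exp (- (cmod w)\<^sup>2) / pi))"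
    using gaussians by (simp add: indep_std_complex_gaussians_def)
  hence "distr M lborel (\<phi> n) = density lborel gauss_density"
    by (simp add: distributed_def gauss_density_def[abs_def])
  moreover have "distr M borel (\<phi> n) = distr M lborel (\<phi> n)" by (rule distr_cong) auto
  ultimately show ?thesis by simp
qed

lemma \<phi>_measurable [measurable]: "\<phi> n \<in> borel_measurable M"
  using indep by (auto simp: indep_vars_def)

lemma emeasure_\<phi>:
  assumes "A \<in> sets borel"
  shows "emeasure M {\<omega>\<in>space M. \<phi> n \<omega> \<in> A} = (\<integral>\<^sup>+w. gauss_density w * indicator A w \<partial>lborel)"
proof -
  have "emeasure M {\<omega>\<in>space M. \<phi> n \<omega> \<in> A} = emeasure (distr M borel (\<phi> n)) A"
    using assms by (subst emeasure_distr) (auto intro!: arg_cong[where f = "emeasure M"])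
  thus ?thesis using assms unfolding distr_\<phi> by (simp add: emeasure_density)
qed

text \<open>The density is bounded below by its value at distance \<open>norm c + \<rho>\<close>
  from 0, and multiplied by the area of the disk.\<close>

lemma prob_\<phi>_cball_ge:
  assumes \<rho>: "\<rho> \<ge> 0"
  shows "prob {\<omega>\<in>space M. \<phi> n \<omega> \<in> cball c \<rho>} \<ge> exp (- (norm c + \<rho>)\<^sup>2) * \<rho>\<^sup>2"
proof -
  have "ennreal (exp (- (norm c + \<rho>)\<^sup>2) * \<rho>\<^sup>2) = (\<integral>\<^sup>+w. ennreal (exp (- (norm c + \<rho>)\<^sup>2) / pi) * indicator (cball c \<rho>) w \<partial>lborel)"
    using \<rho> by (subst nn_integral_cmult_indicator) (auto simp: emeasure_cball_complex simp flip: ennreal_mult)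
  also have "\<dots> \<le> (\<integral>\<^sup>+w. gauss_density w * indicator (cball c \<rho>) w \<partial>lborel)"
  proof (intro nn_integral_mono)
    fix w
    show "ennreal (exp (- (norm c + \<rho>)\<^sup>2) / pi) * indicator (cball c \<rho>) w \<le> gauss_density w * indicator (cball c \<rho>) w"
    proof (cases "w \<in> cball c \<rho>")
      case True
      have "norm w \<le> norm c + \<rho>"
        using True norm_triangle_sub[of w c] by (simp add: dist_norm norm_minus_commute)
      hence "(norm w)\<^sup>2 \<le> (norm c + \<rho>)\<^sup>2" by (intro power_mono) auto
      thus ?thesis unfolding gauss_density_def by (intro mult_right_mono ennreal_leI divide_right_mono) auto
    qed simp
  qed
  also have "\<dots> = emeasure M {\<omega>\<in>space M. \<phi> n \<omega> \<in> cball c \<rho>}" by (rule emeasure_\<phi>[symmetric]) simp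
  finally show ?thesis unfolding emeasure_eq_measure by simp
qed

lemma prob_\<phi>_small_le:
  assumes \<rho>: "\<rho> \<ge> 0"
  shows "prob {\<omega>\<in>space M. norm (\<phi> n \<omega>) \<le> \<rho>} \<le> \<rho>\<^sup>2"
proof -
  have "emeasure M {\<omega>\<in>space M. \<phi> n \<omega> \<in> cball 0 \<rho>} = (\<integral>\<^sup>+w. gauss_density w * indicator (cball 0 \<rho>) w \<partial>lborel)"
    by (rule emeasure_\<phi>) simp
  also have "\<dots> \<le> (\<integral>\<^sup>+w. ennreal (1 / pi) * indicator (cball 0 \<rho>) (w::complex) \<partial>lborel)"
    unfolding gauss_density_def by (intro nn_integral_mono mult_right_mono ennreal_leI divide_right_mono) auto
  also have "\<dots> = ennreal (\<rho>\<^sup>2)"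
    using \<rho> by (subst nn_integral_cmult_indicator) (auto simp: emeasure_cball_complex simp flip: ennreal_mult)
  finally show ?thesis unfolding emeasure_eq_measure by simp
qed

lemma nn_integral_gauss_density: "(\<integral>\<^sup>+w. gauss_density w \<partial>lborel) = 1"
  using emeasure_\<phi>[of UNIV] by (simp add: emeasure_space_1)

text \<open>Half of the exponent is used for the bound, and the other half for integrability.\<close>

lemma prob_\<phi>_large_le:
  assumes x: "x \<ge> 0"
  shows "prob {\<omega>\<in>space M. norm (\<phi> n \<omega>) > x} \<le> 2 * exp (- x\<^sup>2 / 2)"
proof -
  have "emeasure M {\<omega>\<in>space M. \<phi> n \<omega> \<in> - cball 0 x} = (\<integral>\<^sup>+w. gauss_density w * indicator (- cball 0 x) w \<partial>lborel)"
    by (rule emeasure_\<phi>) simp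
  also have "\<dots> \<le> (\<integral>\<^sup>+w. ennreal (exp (- x\<^sup>2 / 2)) * gauss_density (0 + of_real (1 / sqrt 2) * w) \<partial>lborel)"
  proof (intro nn_integral_mono)
    fix w :: complex
    show "gauss_density w * indicator (- cball 0 x) w \<le> ennreal (exp (- x\<^sup>2 / 2)) * gauss_density (0 + of_real (1 / sqrt 2) * w)"
    proof (cases "w \<in> cball 0 x")
      case False
      hence "x\<^sup>2 \<le> (norm w)\<^sup>2" using x by (intro power_mono) auto
      hence "exp (- (norm w)\<^sup>2) \<le> exp (- x\<^sup>2 / 2 - (norm w)\<^sup>2 / 2)" by simp
      also have "\<dots> = exp (- x\<^sup>2 / 2) * exp (- (norm w)\<^sup>2 / 2)" by (simp add: exp_add[symmetric])
      finally show ?thesis using False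
        by (simp add: gauss_density_def norm_mult norm_divide power_divide divide_right_mono flip: ennreal_mult)
    qed simp
  qed
  also have "\<dots> = ennreal (exp (- x\<^sup>2 / 2)) * (ennreal (1 / (1 / sqrt 2)\<^sup>2) * (\<integral>\<^sup>+w. gauss_density w \<partial>lborel))"
    by (subst nn_integral_cmult, measurable, subst nn_integral_lborel_affine) auto
  also have "\<dots> = ennreal (2 * exp (- x\<^sup>2 / 2))"
    unfolding nn_integral_gauss_density by (simp add: power_divide ennreal_mult' mult.commute)
  finally show ?thesis unfolding emeasure_eq_measure by (simp add: not_le)
qed

text \<open>The first m events are independent. From their intersection one removes, by a union
  bound, the outcomes where a later event fails; independence keeps the factor P in each of these
  probabilities.\<close>

lemma prob_independent_events_ge:
  fixes A :: "nat \<Rightarrow> complex set"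
  assumes A [measurable]: "\<And>n. A n \<in> sets borel"
    and b: "\<And>k. prob {\<omega>\<in>space M. \<phi> (m + k) \<omega> \<notin> A (m + k)} \<le> b k" "b sums s"
  shows "(1 - s) * (\<Prod>n<m. prob {\<omega>\<in>space M. \<phi> n \<omega> \<in> A n}) \<le> prob {\<omega>\<in>space M. \<forall>n. \<phi> n \<omega> \<in> A n}"
proof -
  define P where "P = (\<Prod>n<m. prob {\<omega>\<in>space M. \<phi> n \<omega> \<in> A n})"
  define E where "E = {\<omega>\<in>space M. \<forall>n<m. \<phi> n \<omega> \<in> A n}"
  define D where "D k = {\<omega>\<in>space M. (\<forall>n<m. \<phi> n \<omega> \<in> A n) \<and> \<phi> (m + k) \<omega> \<notin> A (m + k)}" for k
  have [measurable]: "E \<in> sets M" "D k \<in> sets M" for k unfolding E_def D_def by measurable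
  have vim: "\<phi> n -` X \<inter> space M = {\<omega>\<in>space M. \<phi> n \<omega> \<in> X}" for n X by auto
  have PE: "prob E = P"
  proof (cases "m = 0")
    case True
    thus ?thesis by (simp add: E_def P_def prob_space)
  next
    case False
    have "prob (\<Inter>n\<in>{..<m}. \<phi> n -` A n \<inter> space M) = (\<Prod>n\<in>{..<m}. prob (\<phi> n -` A n \<inter> space M))"
      using False by (intro indep_varsD[OF indep]) auto
    moreover have "(\<Inter>n\<in>{..<m}. \<phi> n -` A n \<inter> space M) = E" using False by (auto simp: E_def)
    ultimately show ?thesis by (simp add: P_def vim)
  qed
  have PD: "prob (D k) \<le> P * b k" for k
  proof -
    \<comment> \<open>Complementing the set at the index m + k writes \<open>D k\<close> as an
      intersection of independent events.\<close>
    define A' where "A' n = (if n = m + k then - A n else A n)" for n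
    have "prob (\<Inter>n\<in>insert (m + k) {..<m}. \<phi> n -` A' n \<inter> space M) = (\<Prod>n\<in>insert (m + k) {..<m}. prob (\<phi> n -` A' n \<inter> space M))"
      by (intro indep_varsD[OF indep]) (auto simp: A'_def)
    moreover have "(\<Inter>n\<in>insert (m + k) {..<m}. \<phi> n -` A' n \<inter> space M) = D k"
      by (auto simp: D_def A'_def)
    ultimately have "prob (D k) = prob {\<omega>\<in>space M. \<phi> (m + k) \<omega> \<notin> A (m + k)} * P"
      by (simp add: P_def vim A'_def)
    also have "\<dots> \<le> b k * P" using b(1) by (intro mult_right_mono) (auto simp: P_def intro!: prod_nonneg)
    finally show ?thesis by (simp add: mult.commute)
  qed
  have sPb: "(\<lambda>k. P * b k) sums (P * s)" using b(2) by (rule sums_mult)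
  have sD: "summable (\<lambda>k. prob (D k))"
    by (rule summable_comparison_test'[OF sums_summable[OF sPb], of 0]) (use PD in auto)
  have "prob (\<Union>k. D k) \<le> (\<Sum>k. prob (D k))"
    by (rule finite_measure_subadditive_countably) (use sD in auto)
  also have "\<dots> \<le> P * s"
    using suminf_le[OF PD sD sums_summable[OF sPb]] sums_unique[OF sPb] by simp
  finally have UD: "prob (\<Union>k. D k) \<le> P * s" .
  have "prob E \<le> prob ({\<omega>\<in>space M. \<forall>n. \<phi> n \<omega> \<in> A n} \<union> (\<Union>k. D k))"
  proof (rule finite_measure_mono)
    show "E \<subseteq> {\<omega>\<in>space M. \<forall>n. \<phi> n \<omega> \<in> A n} \<union> (\<Union>k. D k)"
    proof
      fix \<omega> assume \<omega>: "\<omega> \<in> E"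
      show "\<omega> \<in> {\<omega>\<in>space M. \<forall>n. \<phi> n \<omega> \<in> A n} \<union> (\<Union>k. D k)"
      proof (rule ccontr)
        assume "\<omega> \<notin> {\<omega>\<in>space M. \<forall>n. \<phi> n \<omega> \<in> A n} \<union> (\<Union>k. D k)"
        then obtain n where n: "\<phi> n \<omega> \<notin> A n" "\<And>k. \<omega> \<notin> D k" using \<omega> by (auto simp: E_def)
        hence "n \<ge> m" using \<omega> by (auto simp: E_def not_less[symmetric])
        thus False using n(1) n(2)[of "n - m"] \<omega> by (auto simp: E_def D_def)
      qed
    qed
  qed measurable
  also have "\<dots> \<le> prob {\<omega>\<in>space M. \<forall>n. \<phi> n \<omega> \<in> A n} + prob (\<Union>k. D k)"
    by (rule measure_Un_le) measurable
  finally show ?thesis using PE UD unfolding P_def[symmetric] by (simp add: algebra_simps)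
qed

text \<open>By compactness and continuity, f has no zero in the disk iff its modulus is at least
  some 1 / (k + 1) on a countable dense subset, which leaves countable operations only.\<close>

lemma hole_event_measurable:
  assumes r: "r \<ge> 0"
  shows "hole_event M \<phi> a r \<in> sets M"
proof -
  define F where "F = gaussian_series \<phi> a"
  define conv where "conv = {\<omega>\<in>space M. conv_radius (\<lambda>n. \<phi> n \<omega> * of_real (a (real n))) = \<infinity>}"
  have [measurable]: "conv \<in> sets M"
    unfolding conv_def conv_radius_def by measurable
  have [measurable]: "(\<lambda>\<omega>. F \<omega> z) \<in> borel_measurable M" for z
    unfolding F_def gaussian_series_def by measurable
  obtain T where T: "countable T" "T \<subseteq> cball (0::complex) r" "cball 0 r \<subseteq> closure T"
    by (rule separable)
  have "T \<noteq> {}" using T(3) r by auto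
  have cont: "continuous_on (cball 0 r) (\<lambda>z. norm (F \<omega> z))" if "\<omega> \<in> conv" for \<omega>
    using that unfolding F_def gaussian_series_def conv_def
    by (intro continuous_on_norm holomorphic_on_imp_continuous_on holomorphic_on_power_series) auto
  have "hole_event M \<phi> a r = conv \<inter> (\<Union>k::nat. \<Inter>z\<in>T. {\<omega>\<in>space M. norm (F \<omega> z) \<ge> 1 / real (Suc k)})"
  proof (intro equalityI subsetI)
    fix \<omega> assume \<omega>: "\<omega> \<in> hole_event M \<phi> a r"
    hence c: "\<omega> \<in> conv" by (auto simp: hole_event_def conv_def)
    obtain z0 where z0: "z0 \<in> cball 0 r" "\<And>z. z \<in> cball 0 r \<Longrightarrow> norm (F \<omega> z0) \<le> norm (F \<omega> z)"
      using continuous_attains_inf[OF compact_cball _ cont[OF c]] r by force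
    have "norm (F \<omega> z0) > 0" using \<omega> z0(1) by (auto simp: hole_event_def F_def)
    then obtain k where "1 / real (Suc k) < norm (F \<omega> z0)"
      using nat_approx_posE by blast
    hence "1 / real (Suc k) \<le> norm (F \<omega> z)" if "z \<in> T" for z
      using z0(2)[of z] T(2) that by (auto simp: subset_eq)
    thus "\<omega> \<in> conv \<inter> (\<Union>k::nat. \<Inter>z\<in>T. {\<omega>\<in>space M. norm (F \<omega> z) \<ge> 1 / real (Suc k)})"
      using c unfolding conv_def by blast
  next
    fix \<omega> assume "\<omega> \<in> conv \<inter> (\<Union>k::nat. \<Inter>z\<in>T. {\<omega>\<in>space M. norm (F \<omega> z) \<ge> 1 / real (Suc k)})"
    then obtain k where c: "\<omega> \<in> conv" and k: "\<And>z. z \<in> T \<Longrightarrow> norm (F \<omega> z) \<ge> 1 / real (Suc k)" by auto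
    have "closed {z \<in> cball 0 r. 1 / real (Suc k) \<le> norm (F \<omega> z)}"
      using continuous_closed_preimage[OF cont[OF c] closed_cball closed_atLeast, of "1 / real (Suc k)"]
      by (simp add: vimage_def Int_def)
    moreover have "T \<subseteq> {z \<in> cball 0 r. 1 / real (Suc k) \<le> norm (F \<omega> z)}" using k T(2) by auto
    ultimately have "closure T \<subseteq> {z \<in> cball 0 r. 1 / real (Suc k) \<le> norm (F \<omega> z)}"
      by (rule closure_minimal[rotated])
    hence "1 / real (Suc k) \<le> norm (F \<omega> z)" if "norm z \<le> r" for z using T(3) that by auto
    hence "F \<omega> z \<noteq> 0" if "norm z \<le> r" for z using that by force
    thus "\<omega> \<in> hole_event M \<phi> a r" using c by (auto simp: hole_event_def conv_def F_def)
  qed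
  also have "\<dots> \<in> sets M"
  proof -
    have "(\<Inter>z\<in>T. {\<omega>\<in>space M. norm (F \<omega> z) \<ge> 1 / real (Suc k)}) \<in> sets M" for k
      using T(1) \<open>T \<noteq> {}\<close> by (intro sets.countable_INT') (auto simp del: of_nat_Suc)
    thus ?thesis by measurable
  qed
  finally show ?thesis .
qed

end

section \<open>Lower bound for the hole probability\<close>

locale gaussian_entire_function = log_concave_weights a + gaussian_coefficients M \<phi>
  for a :: "real \<Rightarrow> real" and M :: "'w measure" and \<phi> :: "nat \<Rightarrow> 'w \<Rightarrow> complex"
begin

text \<open>On the event constructed, the constant term exceeds K a(0), the terms 1..N add up to at
  most 1 and the tail to at most 12 / \<delta>^2, so f cannot vanish. The small disks for 1..N cost
  S and the logarithmic term.\<close>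

lemma P_H_ge:
  assumes r: "r \<ge> R0" and \<delta>: "0 < \<delta>" "\<delta> \<le> 1"
    and tail: "\<And>k. h r (Suc (N r) + k) \<le> - real k * \<delta>"
    and K: "K \<ge> 0" "1 + 12 / \<delta>\<^sup>2 < K * a 0"
  shows "P_H M \<phi> a r \<ge> exp (- (K + 2)\<^sup>2 - S a r - real (N r) * (1 + 2 * ln (real (N r)))) / 2"
proof -
  define n0 where "n0 = N r"
  have n0: "n0 \<ge> 1" using N_ge_1[OF r] by (simp add: n0_def)
  \<comment> \<open>The disk around K + 1 keeps the modulus of \<phi>(0) at least K. At index N + 1
    + k the radius is k + 3, which is at most 3 (k + 1).\<close>
  define A :: "nat \<Rightarrow> complex set" where
    "A n = (if n = 0 then cball (of_real (K + 1)) 1 else if n \<le> n0 then cball 0 (exp (- h r n) / n0)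
            else cball 0 (real n - real n0 + 2))" for n
  have A [measurable]: "A n \<in> sets borel" for n by (simp add: A_def)
  define E where "E = {\<omega>\<in>space M. \<forall>n. \<phi> n \<omega> \<in> A n}"
  have [measurable]: "E \<in> sets M" unfolding E_def by measurable
  have sub: "E \<subseteq> hole_event M \<phi> a r"
  proof
    fix \<omega> assume \<omega>: "\<omega> \<in> E"
    have tailx: "norm (\<phi> (Suc (N r) + k) \<omega>) \<le> 3 * (real k + 1)" for k
    proof -
      have "\<phi> (Suc (N r) + k) \<omega> \<in> A (Suc (N r) + k)" using \<omega> by (simp add: E_def)
      thus ?thesis by (simp add: A_def n0_def)
    qed
    have headx: "norm (\<phi> n \<omega>) * exp (h r n) \<le> 1 / real n0" if "n \<in> {1..N r}" for n
    proof -
      have "\<phi> n \<omega> \<in> A n" using \<omega> by (simp add: E_def)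
      hence "norm (\<phi> n \<omega>) \<le> exp (- h r n) / real n0" using that by (simp add: A_def n0_def split: if_splits)
      thus ?thesis using n0 by (simp add: exp_minus field_simps)
    qed
    have "\<phi> 0 \<omega> \<in> A 0" using \<omega> by (simp add: E_def)
    hence "norm (of_real (K + 1) - \<phi> 0 \<omega>) \<le> 1" by (simp add: A_def dist_norm)
    moreover have "norm (of_real (K + 1) :: complex) = K + 1" using K by (simp only: norm_of_real)
    ultimately have x0: "K \<le> norm (\<phi> 0 \<omega>)"
      using norm_triangle_ineq2[of "of_real (K + 1)" "\<phi> 0 \<omega>"] by linarith
    have conv: "conv_radius (\<lambda>n. \<phi> n \<omega> * of_real (a (real n))) = \<infinity>"
    proof (rule conv_radius_infinite[of "Suc (N r)" _ 3])
      fix n assume n: "Suc (N r) \<le> n"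
      show "norm (\<phi> n \<omega>) \<le> 3 * (real n + 1)"
        using tailx[of "n - Suc (N r)"] n by (simp add: of_nat_diff)
    qed
    have "gaussian_series \<phi> a \<omega> z \<noteq> 0" if "norm z \<le> r" for z
    proof
      assume "gaussian_series \<phi> a \<omega> z = 0"
      hence "norm (\<phi> 0 \<omega> * of_real (a 0)) \<le> (\<Sum>n=1..N r. norm (\<phi> n \<omega>) * exp (h r n)) + 3 * (4 / \<delta>\<^sup>2)"
        using norm_series_diff_le[OF r \<delta> tail tailx that] by (simp add: gaussian_series_def)
      also have "(\<Sum>n=1..N r. norm (\<phi> n \<omega>) * exp (h r n)) \<le> (\<Sum>n=1..N r. 1 / real n0)"
        by (intro sum_mono headx)
      also have "\<dots> = 1" using n0 by (simp add: n0_def)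
      also have "1 + 3 * (4 / \<delta>\<^sup>2) < K * a 0" using K by simp
      also have "\<dots> \<le> norm (\<phi> 0 \<omega> * of_real (a 0))"
        using x0 a_pos[of 0] by (simp add: norm_mult)
      finally show False by simp
    qed
    thus "\<omega> \<in> hole_event M \<phi> a r" using \<omega> conv by (simp add: hole_event_def E_def)
  qed
  \<comment> \<open>The tail events fail with probability at most 2^(-k) / 4, which sums to
    1/2.\<close>
  have "prob E \<ge> (1 - 1 / 2) * (\<Prod>n<Suc n0. prob {\<omega>\<in>space M. \<phi> n \<omega> \<in> A n})"
    unfolding E_def
  proof (rule prob_independent_events_ge)
    fix k
    have "prob {\<omega>\<in>space M. \<phi> (Suc n0 + k) \<omega> \<notin> A (Suc n0 + k)} = prob {\<omega>\<in>space M. norm (\<phi> (Suc n0 + k) \<omega>) > real k + 3}"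
      by (simp add: A_def not_le add_ac)
    also have "\<dots> \<le> 2 * exp (- (real k + 3)\<^sup>2 / 2)" by (rule prob_\<phi>_large_le) simp
    also have "exp (- (real k + 3)\<^sup>2 / 2) \<le> exp (- real (k + 3))"
    proof -
      define x where "x = real k + 3"
      have "2 * x \<le> x * x" by (rule mult_right_mono) (auto simp: x_def)
      moreover have "real (k + 3) = x" by (simp add: x_def)
      ultimately show ?thesis unfolding x_def[symmetric] by (simp add: power2_eq_square)
    qed
    also have "\<dots> = exp (-1) ^ (k + 3)" by (simp flip: exp_of_nat_mult)
    also have "\<dots> \<le> (1 / 2) ^ (k + 3)"
      using exp_ge_add_one_self[of 1] by (intro power_mono) (auto simp: exp_minus field_simps)
    finally show "prob {\<omega>\<in>space M. \<phi> (Suc n0 + k) \<omega> \<notin> A (Suc n0 + k)} \<le> (1 / 4) * (1 / 2) ^ k"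
      by (simp add: power_add power3_eq_cube)
  next
    have "(\<lambda>k. (1 / 4) * (1 / 2) ^ k) sums ((1 / 4) * (1 / (1 - 1 / 2 :: real)))"
      by (intro sums_mult geometric_sums) simp
    thus "(\<lambda>k. (1 / 4) * (1 / 2) ^ k) sums (1 / 2 :: real)" by simp
  qed simp
  moreover have "(\<Prod>n<Suc n0. prob {\<omega>\<in>space M. \<phi> n \<omega> \<in> A n}) \<ge>
      exp (- (K + 2)\<^sup>2) * (\<Prod>n=1..n0. exp (- 1 - 2 * h r n - 2 * ln (real n0)))"
  proof -
    have "(\<Prod>n<Suc n0. prob {\<omega>\<in>space M. \<phi> n \<omega> \<in> A n})
        = prob {\<omega>\<in>space M. \<phi> 0 \<omega> \<in> A 0} * (\<Prod>n=1..n0. prob {\<omega>\<in>space M. \<phi> n \<omega> \<in> A n})"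
    proof -
      have "{..<Suc n0} = insert 0 {1..n0}" by auto
      thus ?thesis by (simp del: prod.lessThan_Suc)
    qed
    moreover have "exp (- (K + 2)\<^sup>2) \<le> prob {\<omega>\<in>space M. \<phi> 0 \<omega> \<in> A 0}"
    proof -
      have "norm (of_real (K + 1) :: complex) + 1 = K + 2" using K by (simp only: norm_of_real)
      thus ?thesis using prob_\<phi>_cball_ge[of 1 "of_real (K + 1)" 0] by (simp add: A_def add.commute)
    qed
    moreover have "exp (- 1 - 2 * h r n - 2 * ln (real n0)) \<le> prob {\<omega>\<in>space M. \<phi> n \<omega> \<in> A n}"
      if n: "n \<in> {1..n0}" for n
    proof -
      define \<rho> where "\<rho> = exp (- h r n) / n0"
      have "h r n \<ge> 0" using h_nonneg[OF r] n by (simp add: n0_def)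
      hence "exp (- h r n) \<le> 1" by simp
      also have "1 \<le> real n0" using n0 by simp
      finally have \<rho>: "0 \<le> \<rho>" "\<rho> \<le> 1" using n0 by (auto simp: \<rho>_def)
      have eq: "\<rho> = exp (- h r n - ln (real n0))" using n0 by (simp add: \<rho>_def exp_diff)
      have "exp (- 1 - 2 * h r n - 2 * ln (real n0)) = exp (- 1) * \<rho>\<^sup>2"
        unfolding eq by (simp flip: exp_add exp_of_nat_mult add: algebra_simps)
      \<comment> \<open>As \<rho> \<le> 1, the density loses at most the factor exp(-1); this is the
        1 in \<open>1 + 2 * ln (real (N r))\<close>.\<close>
      also have "\<dots> \<le> exp (- (norm (0::complex) + \<rho>)\<^sup>2) * \<rho>\<^sup>2"
        using \<rho> by (intro mult_right_mono) (auto simp: power_le_one)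
      also have "\<dots> \<le> prob {\<omega>\<in>space M. \<phi> n \<omega> \<in> cball 0 \<rho>}" by (rule prob_\<phi>_cball_ge) (rule \<rho>)
      finally show ?thesis using n by (simp add: A_def \<rho>_def)
    qed
    ultimately show ?thesis by (auto intro!: mult_mono prod_mono prod_nonneg)
  qed
  moreover have "exp (- (K + 2)\<^sup>2 - S a r - real (N r) * (1 + 2 * ln (real (N r))))
      \<le> exp (- (K + 2)\<^sup>2) * (\<Prod>n=1..n0. exp (- 1 - 2 * h r n - 2 * ln (real n0)))"
  proof -
    have "(\<Prod>n=1..n0. exp (- 1 - 2 * h r n - 2 * ln (real n0))) = exp (\<Sum>n=1..n0. - 1 - 2 * h r n - 2 * ln (real n0))"
      by (simp add: exp_sum)
    also have "(\<Sum>n=1..n0. - 1 - 2 * h r n - 2 * ln (real n0)) = - 2 * (\<Sum>n=1..n0. h r n) - real n0 * (1 + 2 * ln (real n0))"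
      unfolding sum_subtractf sum_distrib_left[symmetric] by (simp add: algebra_simps)
    finally show ?thesis using sum_h_le_S[OF r] by (simp add: n0_def flip: exp_add)
  qed
  moreover have "prob E \<le> P_H M \<phi> a r"
    unfolding P_H_def using sub hole_event_measurable[of r a] r_pos[OF r] by (intro finite_measure_mono) auto
  ultimately show ?thesis by simp
qed

end

section \<open>Upper bound for the hole probability\<close>

text \<open>A majorant on \<open>{0<..R}\<close> of \<open>x powr (\<eta> - 2)\<close> whose radial integral over the plane is computed from
  areas of disks alone.\<close>

definition power_majorant :: "real \<Rightarrow> real \<Rightarrow> real \<Rightarrow> ennreal" where
  "power_majorant R \<eta> x = (\<Sum>k. ennreal ((R / 2 ^ Suc k) powr (\<eta> - 2)) * indicator {..R / 2 ^ k} x)"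

lemma power_majorant_measurable [measurable]: "power_majorant R \<eta> \<in> borel_measurable borel"
  unfolding power_majorant_def by measurable

text \<open>If R / 2^(j+1) < x \<le> R / 2^j, the j-th term of the majorant alone suffices.\<close>

lemma powr_le_power_majorant:
  assumes x: "0 < x" "x \<le> R" and \<eta>: "\<eta> \<le> 2"
  shows "ennreal (x powr (\<eta> - 2)) \<le> power_majorant R \<eta> x"
proof -
  have "\<exists>k. R / 2 ^ k < x"
  proof -
    obtain k where "R / x < 2 ^ k" using real_arch_pow[of 2 "R / x"] by auto
    thus ?thesis using x by (intro exI[of _ k]) (simp add: field_simps)
  qed
  then obtain k where k: "R / 2 ^ k < x" "\<And>j. j < k \<Longrightarrow> \<not> R / 2 ^ j < x"
    using exists_least_iff[of "\<lambda>k. R / 2 ^ k < x"] by blast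
  then obtain j where j: "k = Suc j" using x by (cases k) auto
  have "x powr (\<eta> - 2) \<le> (R / 2 ^ Suc j) powr (\<eta> - 2)"
    using k(1) x \<eta> by (intro powr_mono2') (auto simp: j)
  hence "ennreal (x powr (\<eta> - 2)) \<le> ennreal ((R / 2 ^ Suc j) powr (\<eta> - 2)) * indicator {..R / 2 ^ j} x"
    using k(2)[of j] by (auto simp: j intro: ennreal_leI)
  also have "\<dots> = (\<Sum>k\<in>{j}. ennreal ((R / 2 ^ Suc k) powr (\<eta> - 2)) * indicator {..R / 2 ^ k} x)"
    by (simp only: sum.insert finite.emptyI empty_iff sum.empty add_0_right not_False_eq_True)
  also have "\<dots> \<le> power_majorant R \<eta> x"
    unfolding power_majorant_def by (rule sum_le_suminf) auto
  finally show ?thesis .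
qed

text \<open>The disk of radius R / 2^k contributes 4 pi R^\<eta> q^(k+1) with q = 2^(-\<eta>), a
  geometric series. A positive \<eta> is essential, since the power -2 is not integrable at 0 in the
  plane.\<close>

lemma nn_integral_power_majorant_le:
  assumes R: "R > 0" and \<eta>: "0 < \<eta>" 
  shows "(\<integral>\<^sup>+w. power_majorant R \<eta> (norm (w::complex)) \<partial>lborel) \<le> ennreal (8 * pi * R powr \<eta> / \<eta>)"
proof -
  define q where "q = 2 powr (- \<eta>)"
  have q: "0 < q" "q < 1" using \<eta> by (auto simp: q_def powr_less_one)
  have shell: "(\<integral>\<^sup>+w. ennreal ((R / 2 ^ Suc k) powr (\<eta> - 2)) * indicator {..R / 2 ^ k} (norm (w::complex)) \<partial>lborel)
      = ennreal (4 * pi * R powr \<eta> * q * q ^ k)" for k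
  proof -
    define x where "x = R / 2 ^ Suc k"
    have x: "x > 0" "R / 2 ^ k = 2 * x" using R by (auto simp: x_def)
    have "(\<integral>\<^sup>+w. ennreal (x powr (\<eta> - 2)) * indicator {..2 * x} (norm (w::complex)) \<partial>lborel)
        = (\<integral>\<^sup>+w. ennreal (x powr (\<eta> - 2)) * indicator (cball 0 (2 * x)) (w::complex) \<partial>lborel)"
      by (intro nn_integral_cong) (auto simp: indicator_def)
    also have "\<dots> = ennreal (x powr (\<eta> - 2) * (pi * (2 * x)\<^sup>2))"
      using x by (subst nn_integral_cmult_indicator) (auto simp: emeasure_cball_complex simp flip: ennreal_mult)
    also have "x powr (\<eta> - 2) * (pi * (2 * x)\<^sup>2) = 4 * pi * x powr \<eta>"
      using x by (simp add: powr_diff power_mult_distrib)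
    also have "x powr \<eta> = R powr \<eta> * q * q ^ k"
    proof -
      have "x = R * 2 powr (- real (Suc k))"
        by (simp only: x_def powr_minus powr_realpow) (simp add: divide_inverse powr_realpow del: of_nat_Suc power_Suc)
      hence "x powr \<eta> = R powr \<eta> * (2 powr (- \<eta>)) powr real (Suc k)"
        using R by (simp add: powr_mult powr_powr algebra_simps)
      also have "(2 powr (- \<eta>)) powr real (Suc k) = q ^ Suc k"
        unfolding q_def by (rule powr_realpow) simp
      finally show ?thesis by (simp add: mult_ac)
    qed
    finally show ?thesis unfolding x(2) x_def[symmetric] by (simp add: mult_ac)
  qed
  have sums: "(\<lambda>k. 4 * pi * R powr \<eta> * q * q ^ k) sums (4 * pi * R powr \<eta> * q * (1 / (1 - q)))"
    using q by (intro sums_mult geometric_sums) auto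
  have "(\<integral>\<^sup>+w. power_majorant R \<eta> (norm (w::complex)) \<partial>lborel)
     = (\<Sum>k. \<integral>\<^sup>+w. ennreal ((R / 2 ^ Suc k) powr (\<eta> - 2)) * indicator {..R / 2 ^ k} (norm (w::complex)) \<partial>lborel)"
    unfolding power_majorant_def by (rule nn_integral_suminf) measurable
  also have "\<dots> = (\<Sum>k. ennreal (4 * pi * R powr \<eta> * q * q ^ k))" by (simp only: shell)
  also have "\<dots> = ennreal (4 * pi * R powr \<eta> * q * (1 / (1 - q)))"
    using q sums by (subst suminf_ennreal2) (auto simp: sums_iff)
  also have "\<dots> \<le> ennreal (8 * pi * R powr \<eta> / \<eta>)"
  proof (rule ennreal_leI)
    have "1 + \<eta> / 2 \<le> 1 + \<eta> * ln 2" using \<eta> exp_half_le2 ln_ge_iff[of 2 "1 / 2"] by (simp add: field_simps)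
    also have "\<dots> \<le> 1 / q" using exp_ge_add_one_self[of "\<eta> * ln 2"]
      by (simp add: q_def powr_def divide_inverse exp_minus)
    finally have "\<eta> / 2 * q \<le> 1 - q" using q by (simp add: field_simps)
    hence "q * (1 / (1 - q)) \<le> 2 / \<eta>" using q \<eta> by (simp add: field_simps)
    hence "4 * pi * R powr \<eta> * (q * (1 / (1 - q))) \<le> 4 * pi * R powr \<eta> * (2 / \<eta>)"
      using pi_ge_zero by (intro mult_left_mono) auto
    thus "4 * pi * R powr \<eta> * q * (1 / (1 - q)) \<le> 8 * pi * R powr \<eta> / \<eta>" by simp
  qed
  finally show ?thesis .
qed

lemma prod_mono_ennreal:
  fixes f g :: "'a \<Rightarrow> ennreal"
  assumes "\<And>i. i \<in> A \<Longrightarrow> f i \<le> g i"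
  shows "prod f A \<le> prod g A"
  using assms by (induction A rule: infinite_finite_induct) (auto intro: mult_mono)

section \<open>Conditioning on the tail coefficients\<close>

context gaussian_coefficients
begin

lemma sigma_finite_gauss: "sigma_finite_measure (density lborel gauss_density)"
proof -
  have "prob_space (distr M borel (\<phi> 0))" by (rule prob_space_distr) simp
  thus ?thesis unfolding distr_\<phi> by (rule prob_space_imp_sigma_finite)
qed

text \<open>Head and tail are independent, so a bound for the head integral that is uniform in the
  tail passes to the expectation.\<close>

lemma nn_integral_head_tail_le:
  assumes m: "m > 0"
    and G [measurable]: "G \<in> borel_measurable (PiM {0..<m} (\<lambda>_. borel) \<Otimes>\<^sub>M PiM {m..} (\<lambda>_. borel))"
    and le: "\<And>y. (\<integral>\<^sup>+x. G (x, y) \<partial>PiM {0..<m} (\<lambda>_. density lborel gauss_density)) \<le> b"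
  shows "(\<integral>\<^sup>+\<omega>. G (restrict (\<lambda>i. \<phi> i \<omega>) {0..<m}, restrict (\<lambda>i. \<phi> i \<omega>) {m..}) \<partial>M) \<le> b"
proof -
  define X where "X \<omega> = restrict (\<lambda>i. \<phi> i \<omega>) {0..<m}" for \<omega>
  define Y where "Y \<omega> = restrict (\<lambda>i. \<phi> i \<omega>) {m..}" for \<omega>
  define P where "P = PiM {0..<m} (\<lambda>_::nat. borel :: complex measure)"
  define Q where "Q = PiM {m..} (\<lambda>_::nat. borel :: complex measure)"
  have "indep_var P X Q Y"
    unfolding P_def Q_def X_def Y_def by (rule indep_var_restrict[OF indep]) auto
  hence XY: "X \<in> measurable M P" "Y \<in> measurable M Q"
    "distr M P X \<Otimes>\<^sub>M distr M Q Y = distr M (P \<Otimes>\<^sub>M Q) (\<lambda>x. (X x, Y x))"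
    by (auto simp: indep_var_distribution_eq)
  note [measurable] = XY(1,2)
  have "indep_vars (\<lambda>_. borel) \<phi> {0..<m}" using indep by (rule indep_vars_subset) simp
  hence PX: "distr M P X = PiM {0..<m} (\<lambda>_. density lborel gauss_density)"
    unfolding P_def X_def using m by (subst (asm) indep_vars_iff_distr_eq_PiM') (auto simp: distr_\<phi>)
  interpret X: prob_space "distr M P X" by (rule prob_space_distr) simp
  interpret Y: prob_space "distr M Q Y" by (rule prob_space_distr) simp
  interpret pair_sigma_finite "distr M P X" "distr M Q Y" ..
  have G' [measurable]: "G \<in> borel_measurable (P \<Otimes>\<^sub>M Q)" using G by (simp add: P_def Q_def)
  have eq: "sets (distr M P X \<Otimes>\<^sub>M distr M Q Y) = sets (P \<Otimes>\<^sub>M Q)"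
    by (intro sets_pair_measure_cong) simp_all
  have G'': "G \<in> borel_measurable (distr M P X \<Otimes>\<^sub>M distr M Q Y)"
    using G' unfolding measurable_cong_sets[OF eq refl] .
  have "(\<integral>\<^sup>+\<omega>. G (X \<omega>, Y \<omega>) \<partial>M) = (\<integral>\<^sup>+p. G p \<partial>(distr M P X \<Otimes>\<^sub>M distr M Q Y))"
    unfolding XY(3) by (subst nn_integral_distr) auto
  also have "\<dots> = (\<integral>\<^sup>+y. (\<integral>\<^sup>+x. G (x, y) \<partial>distr M P X) \<partial>distr M Q Y)"
    by (rule nn_integral_snd[symmetric]) (simp add: G'')
  also have "\<dots> \<le> (\<integral>\<^sup>+y. b \<partial>distr M Q Y)"
    unfolding PX by (intro nn_integral_mono le)
  also have "\<dots> = b" using Y.emeasure_space_1 by simp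
  finally show ?thesis by (simp add: X_def Y_def)
qed

text \<open>Supplies the constant C = 1 / pi for \<open>vandermonde_nn_integral_le\<close>.\<close>

lemma nn_integral_gauss_le:
  assumes [measurable]: "f \<in> borel_measurable borel"
  shows "(\<integral>\<^sup>+w. f w \<partial>density lborel gauss_density) \<le> ennreal (1 / pi) * (\<integral>\<^sup>+w. f w \<partial>lborel)"
proof -
  have "(\<integral>\<^sup>+w. f w \<partial>density lborel gauss_density) = (\<integral>\<^sup>+w. gauss_density w * f w \<partial>lborel)"
    by (rule nn_integral_density) auto
  also have "\<dots> \<le> (\<integral>\<^sup>+w. ennreal (1 / pi) * f w \<partial>lborel)"
    unfolding gauss_density_def by (intro nn_integral_mono mult_right_mono ennreal_leI divide_right_mono) auto
  also have "\<dots> = ennreal (1 / pi) * (\<integral>\<^sup>+w. f w \<partial>lborel)" by (rule nn_integral_cmult) simp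
  finally show ?thesis .
qed

end

context gaussian_entire_function
begin

text \<open>The tail acts as the shift t in \<open>vandermonde_nn_integral_le\<close>, with
  monomials a(k) X^k as polynomials. On the circle of radius \<rho> the node differences give the
  product of the \<rho>^n times a factor at least 1.\<close>

lemma nn_integral_prod_circle_le:
  fixes \<psi> :: "real \<Rightarrow> ennreal"
  assumes m: "m > 0" and \<rho>: "\<rho> > 0" and \<psi> [measurable]: "\<psi> \<in> borel_measurable borel"
  defines "z \<equiv> (\<lambda>j. of_real \<rho> * unity_root m ^ j)"
  shows "(\<integral>\<^sup>+\<omega>. (\<Prod>j<m. \<psi> (norm ((\<Sum>n. \<phi> (n + m) \<omega> * of_real (a (real (n + m))) * z j ^ (n + m))
              + (\<Sum>n<m. \<phi> n \<omega> * of_real (a (real n)) * z j ^ n)))) \<partial>M)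
    \<le> (ennreal (1 / pi) * (\<integral>\<^sup>+w. \<psi> (norm (w::complex)) \<partial>lborel)) ^ m
        * ennreal (1 / (\<Prod>n<m. a (real n) * \<rho> ^ n)\<^sup>2)"
proof -
  define t where "t j y = (\<Sum>n. y (n + m) * of_real (a (real (n + m))) * z j ^ (n + m))" for j and y :: "nat \<Rightarrow> complex"
  define P where "P k = monom (of_real (a (real k)) :: complex) k" for k
  define G where "G = (\<lambda>(x, y). \<Prod>j<m. \<psi> (norm (t j y + 1 * (\<Sum>k=0..<0+m. x k * poly (P k) (z j)))))"
  have [measurable]: "t j \<in> borel_measurable (PiM {m..} (\<lambda>_. borel))" for j
    unfolding t_def by measurable
  have G: "G \<in> borel_measurable (PiM {0..<m} (\<lambda>_. borel) \<Otimes>\<^sub>M PiM {m..} (\<lambda>_. borel))"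
    unfolding G_def by measurable
  have zi: "norm (z j - z i) = \<rho> * norm (unity_root m ^ j - unity_root m ^ i)" for i j
    using \<rho> by (simp add: z_def norm_mult flip: right_diff_distrib)
  have zne: "z i \<noteq> z j" if "i < m" "j < i" for i j
  proof
    assume "z i = z j"
    hence "unity_root m ^ i = unity_root m ^ j" using \<rho> by (simp add: z_def)
    hence "i = j" using bij_betw_unity_root_powers[OF m] that by (auto simp: bij_betw_def dest: inj_onD)
    thus False using that by simp
  qed
  define b where "b = (ennreal (1 / pi) * (\<integral>\<^sup>+w. \<psi> (norm (w::complex)) \<partial>lborel)) ^ m
        * ennreal (1 / (\<Prod>n<m. a (real n) * \<rho> ^ n)\<^sup>2)"
  define V where "V = (\<Prod>j<m. \<Prod>i<j. norm (unity_root m ^ j - unity_root m ^ i))"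
  have V: "V \<ge> 1" unfolding V_def by (rule prod_norm_unity_root_diffs_ge_1)
  have "(\<integral>\<^sup>+x. G (x, y) \<partial>PiM {0..<m} (\<lambda>_. density lborel gauss_density)) \<le> b" for y
  proof -
    have "(\<integral>\<^sup>+x. G (x, y) \<partial>PiM {0..<m} (\<lambda>_. density lborel gauss_density)) \<le>
      (ennreal (1 / pi) * (\<integral>\<^sup>+w. \<psi> (norm (w::complex)) \<partial>lborel)) ^ m *
        ennreal (1 / (\<Prod>k=0..<0+m. a (real k))\<^sup>2 / (\<Prod>j<m. norm (1::complex))\<^sup>2 / (\<Prod>j<m. \<Prod>i<j. norm (z j - z i))\<^sup>2)"
      unfolding G_def prod.case
      using vandermonde_nn_integral_le[OF sigma_finite_gauss _ nn_integral_gauss_le \<psi>, where m = m and z = z and l = 0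
          and P = P and c = "\<lambda>k. a (real k)" and d = "\<lambda>_. 1" and t = "\<lambda>j. t j y"] zne a_pos
      by (simp add: P_def degree_monom_eq less_imp_neq[THEN not_sym])
    also have "(\<Prod>j<m. \<Prod>i<j. norm (z j - z i)) = (\<Prod>n<m. \<rho> ^ n) * V"
      unfolding zi V_def by (simp add: prod.distrib)
    also have "1 / (\<Prod>k=0..<0+m. a (real k))\<^sup>2 / (\<Prod>j<m. norm (1::complex))\<^sup>2 / ((\<Prod>n<m. \<rho> ^ n) * V)\<^sup>2
      = 1 / (\<Prod>n<m. a (real n) * \<rho> ^ n)\<^sup>2 / V\<^sup>2"
      by (simp add: prod.distrib power_mult_distrib atLeast0LessThan)
    also have "(ennreal (1 / pi) * (\<integral>\<^sup>+w. \<psi> (norm (w::complex)) \<partial>lborel)) ^ m * ennreal \<dots> \<le> b"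
      unfolding b_def
    proof (intro mult_left_mono ennreal_leI)
      have "1 \<le> V\<^sup>2" using V by (simp add: one_le_power)
      thus "1 / (\<Prod>n<m. a (real n) * \<rho> ^ n)\<^sup>2 / V\<^sup>2 \<le> 1 / (\<Prod>n<m. a (real n) * \<rho> ^ n)\<^sup>2"
        using frac_le[of "1 / (\<Prod>n<m. a (real n) * \<rho> ^ n)\<^sup>2" "1 / (\<Prod>n<m. a (real n) * \<rho> ^ n)\<^sup>2" 1 "V\<^sup>2"] by simp
    qed simp
    finally show ?thesis .
  qed
  from nn_integral_head_tail_le[OF m G this]
  show ?thesis unfolding b_def G_def
    by (simp add: t_def P_def poly_monom atLeast0LessThan add.commute mult_ac)
qed

text \<open>A hole forces one of three events: some coefficient is large, the constant term is tiny,
  or the product G of majorants is large. The first two have probability O(exp(-2 S)); Markov's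
  inequality handles the third.\<close>

lemma P_H_le:
  assumes r: "r \<ge> R0" and S2: "S a r \<ge> 2" and NS: "real (N r) + 1 \<le> 2 * S a r"
    and a0: "(2 * S a r + 2) * a 0 \<le> S a r ^ 2"
    and upper: "(2 * S a r + 2) * a 0 + (real (N r) * ((2 * S a r + real (N r) + 2) * exp (S a r / 2))
        + (2 * S a r + real (N r) + 3) * (4 / (1 / (8 * S a r))\<^sup>2)) \<le> exp (S a r)"
  shows "P_H M \<phi> a r \<le> (1 + 1 / (a 0)\<^sup>2) * exp (- 2 * S a r)
    + exp (- S a r - min 0 (2 * ln (a 0)) + (real (N r) + 1) * (6 * ln (S a r) + 20))"
proof -
  define s where "s = S a r"
  define m where "m = Suc (N r)"
  \<comment> \<open>With q^m = 1 / s the averaging error, of order s q^m, is O(1), while the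
    determinant loses only powers of s with exponent O(m).\<close>
  define q where "q = root m (1 / s)"
  \<comment> \<open>This choice gives (exp s)^\<eta> = e, so the majorant has integral O(s).\<close>
  define \<eta> where "\<eta> = 1 / s"
  define \<psi> where "\<psi> = power_majorant (exp s) \<eta>"
  define z where "z j = of_real (q * r) * unity_root m ^ j" for j
  define H where "H = hole_event M \<phi> a r"
  \<comment> \<open>2 ln s bounds ln of the modulus of f(0), and 8 bounds the averaging error 4 / (1
    - 1/s) for s \<ge> 2.\<close>
  define L where "L = 2 * ln s + 8"
  have s: "s \<ge> 2" "s > 0" using S2 by (auto simp: s_def)
  have lns: "ln s \<ge> 0" using s by simp
  have m: "m > 0" by (simp add: m_def)
  have rp: "r > 0" using r_pos[OF r] by simp
  have q: "0 < q" "q < 1" "q ^ m = 1 / s" using s m by (auto simp: q_def)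
  have [measurable]: "H \<in> sets M" unfolding H_def using rp by (intro hole_event_measurable) simp
  have [measurable]: "\<psi> \<in> borel_measurable borel" unfolding \<psi>_def by measurable
  \<comment> \<open>The threshold makes the union over n cost at most exp(-2 s). Outside
    \<open>small\<close>, f(0) has modulus above exp(-s).\<close>
  define large where "large n = {\<omega>\<in>space M. norm (\<phi> n \<omega>) > 2 * s + real n + 2}" for n
  define small where "small = {\<omega>\<in>space M. norm (\<phi> 0 \<omega>) \<le> exp (- s) / a 0}"
  define G where "G \<omega> = (\<Prod>j<m. \<psi> (norm ((\<Sum>n. \<phi> (n + m) \<omega> * of_real (a (real (n + m))) * z j ^ (n + m))
              + (\<Sum>n<m. \<phi> n \<omega> * of_real (a (real n)) * z j ^ n))))" for \<omega>
  have [measurable]: "G \<in> borel_measurable M" unfolding G_def by measurable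
  define good where "good = {\<omega>\<in>space M. ennreal (exp (- 2 * real m * L)) \<le> G \<omega>}"
  have [measurable]: "large n \<in> sets M" "small \<in> sets M" "good \<in> sets M" for n
    unfolding large_def small_def good_def by measurable

  have "H \<subseteq> (\<Union>n. large n) \<union> small \<union> good"
  proof
    fix \<omega> assume \<omega>: "\<omega> \<in> H"
    hence \<omega>M: "\<omega> \<in> space M" by (simp add: H_def hole_event_def)
    show "\<omega> \<in> (\<Union>n. large n) \<union> small \<union> good"
    proof (rule ccontr)
      assume not: "\<omega> \<notin> (\<Union>n. large n) \<union> small \<union> good"
      define F where "F = gaussian_series \<phi> a \<omega>"
      have conv: "conv_radius (\<lambda>n. \<phi> n \<omega> * of_real (a (real n))) = \<infinity>"
        and nz: "\<And>w. norm w \<le> r \<Longrightarrow> F w \<noteq> 0"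
        using \<omega> by (auto simp: H_def hole_event_def F_def)
      have hol: "F holomorphic_on ball 0 r"
        unfolding F_def gaussian_series_def using holomorphic_on_power_series[OF conv] .
      have x: "norm (\<phi> n \<omega>) \<le> 2 * s + real n + 2" for n
        using not \<omega>M by (auto simp: large_def not_less)
      have x0: "norm (\<phi> 0 \<omega>) > exp (- s) / a 0" using not \<omega>M by (auto simp: small_def)
      have a0p: "a 0 > 0" by (rule a_pos) simp
      have F0: "F 0 = \<phi> 0 \<omega> * of_real (a 0)"
        unfolding F_def gaussian_series_def using suminf_finite[of "{0}" "\<lambda>n. \<phi> n \<omega> * of_real (a (real n)) * 0 ^ n"] by simp
      have lnF0: "- s \<le> ln (norm (F 0))" "ln (norm (F 0)) \<le> 2 * ln s"
      proof -
        have "exp (- s) < norm (F 0)" using x0 a0p by (simp add: F0 norm_mult field_simps)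
        thus "- s \<le> ln (norm (F 0))" using ln_le_cancel_iff[of "exp (- s)" "norm (F 0)"] nz[of 0] rp by simp
        have "norm (F 0) \<le> (2 * s + 2) * a 0" using x[of 0] a0p by (simp add: F0 norm_mult)
        also have "\<dots> \<le> s ^ 2" using a0 by (simp add: s_def)
        finally have "ln (norm (F 0)) \<le> ln (s ^ 2)"
          using nz[of 0] rp s by (subst ln_le_cancel_iff) auto
        thus "ln (norm (F 0)) \<le> 2 * ln s" using s by (simp add: ln_realpow)
      qed
      have Fle: "norm (F w) \<le> exp s" if w: "norm w \<le> r" for w
      proof -
        define \<delta> where "\<delta> = 1 / (8 * s)"
        have \<delta>: "0 < \<delta>" "\<delta> \<le> 1" using s by (auto simp: \<delta>_def)
        have "norm (F w - \<phi> 0 \<omega> * of_real (a 0)) \<le>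
            (\<Sum>n=1..N r. norm (\<phi> n \<omega>) * exp (h r n)) + (2 * s + real (N r) + 3) * (4 / \<delta>\<^sup>2)"
          unfolding F_def gaussian_series_def
        proof (rule norm_series_diff_le[OF r \<delta> _ _ w])
          fix k
          \<comment> \<open>N + 1 \<le> 2 s turns the decay rate of \<open>h_tail\<close> into at
            least 1 / (8 s).\<close>
          have "\<delta> * (2 * (real (N r) + 1)\<^sup>2) \<le> \<delta> * (2 * (2 * s)\<^sup>2)"
            using NS \<delta> by (intro mult_left_mono power_mono) (auto simp: s_def)
          also have "\<dots> = s" using s by (simp add: \<delta>_def power2_eq_square)
          finally have "\<delta> \<le> s / (2 * (real (N r) + 1)\<^sup>2)"
            by (subst pos_le_divide_eq) auto
          hence "real k * \<delta> \<le> real k * (s / (2 * (real (N r) + 1)\<^sup>2))" by (intro mult_left_mono) auto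
          thus "h r (Suc (N r) + k) \<le> - real k * \<delta>"
            using h_tail[OF r, of k] by (simp add: s_def)
          have "norm (\<phi> (Suc (N r) + k) \<omega>) \<le> 2 * s + real (N r) + 3 + real k * 1"
            using x[of "Suc (N r) + k"] by simp
          also have "\<dots> \<le> 2 * s + real (N r) + 3 + real k * (2 * s + real (N r) + 3)"
            using s by (intro add_left_mono mult_left_mono) auto
          finally show "norm (\<phi> (Suc (N r) + k) \<omega>) \<le> (2 * s + real (N r) + 3) * (real k + 1)"
            by (simp add: algebra_simps)
        qed
        also have "(\<Sum>n=1..N r. norm (\<phi> n \<omega>) * exp (h r n)) \<le> (\<Sum>n=1..N r. (2 * s + real (N r) + 2) * exp (s / 2))"
        proof (intro sum_mono mult_mono)
          fix n assume n: "n \<in> {1..N r}"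
          show "norm (\<phi> n \<omega>) \<le> 2 * s + real (N r) + 2" using x[of n] n by simp
          show "exp (h r n) \<le> exp (s / 2)" using h_le_S[OF r] N1_bounds(1)[OF r] n by (auto simp: s_def)
        qed (use s in auto)
        finally have "norm (F w - \<phi> 0 \<omega> * of_real (a 0)) \<le>
            real (N r) * ((2 * s + real (N r) + 2) * exp (s / 2)) + (2 * s + real (N r) + 3) * (4 / \<delta>\<^sup>2)"
          by simp
        moreover have "norm (\<phi> 0 \<omega> * of_real (a 0)) \<le> (2 * s + 2) * a 0"
          using x[of 0] a0p by (simp add: norm_mult)
        ultimately show ?thesis
          using upper norm_triangle_ineq2[of "F w" "\<phi> 0 \<omega> * of_real (a 0)"]
          unfolding s_def[symmetric] \<delta>_def[symmetric] by linarith
      qed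
      have zn: "norm (z j) \<le> r" for j
        using q rp by (simp add: z_def norm_mult norm_power mult_le_cancel_right1)
      have Fz: "0 < norm (F (z j))" "norm (F (z j)) \<le> exp s" for j
        using nz[OF zn] Fle[OF zn] by auto
      \<comment> \<open>Here A = s, and B = 2 s because ln of the modulus of f(0) is at least
        -s.\<close>
      have "(\<Sum>j<m. ln (norm (F (z j)))) \<le> real m * (ln (norm (F 0)) + 2 * (2 * s) * q ^ m / (1 - q ^ m))"
        unfolding z_def
      proof (rule sum_ln_norm_rotations_le[OF hol])
        fix w :: complex assume w: "norm w < r"
        show "F w \<noteq> 0" using nz w by simp
        thus "ln (norm (F w)) \<le> s"
          using Fle[of w] w ln_le_cancel_iff[of "norm (F w)" "exp s"] by simp
      qed (use lnF0 s q m rp in auto)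
      also have "\<dots> \<le> real m * L"
      proof (rule mult_left_mono)
        have "2 * (2 * s) * q ^ m / (1 - q ^ m) \<le> 8"
          unfolding q(3) using s by (simp add: field_simps)
        thus "ln (norm (F 0)) + 2 * (2 * s) * q ^ m / (1 - q ^ m) \<le> L"
          using lnF0(2) by (simp add: L_def)
      qed simp
      finally have sumL: "(\<Sum>j<m. ln (norm (F (z j)))) \<le> real m * L" .
      have \<eta>: "0 \<le> \<eta>" "\<eta> \<le> 1" using s by (auto simp: \<eta>_def)
      have mL: "0 \<le> real m * L" using lns by (simp add: L_def)
      \<comment> \<open>The exponent \<eta> - 2 is negative, so an upper bound for the sum of
        logarithms becomes a lower bound for the product of powers.\<close>
      have "- 2 * real m * L \<le> (\<eta> - 2) * (real m * L)"
        using mult_nonneg_nonneg[OF \<eta>(1) mL] by (simp add: algebra_simps)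
      also have "\<dots> \<le> (\<eta> - 2) * (\<Sum>j<m. ln (norm (F (z j))))"
        using sumL \<eta> by (intro mult_left_mono_neg) auto
      finally have "exp (- 2 * real m * L) \<le> exp (\<Sum>j<m. (\<eta> - 2) * ln (norm (F (z j))))"
        by (simp add: sum_distrib_left)
      also have "\<dots> = (\<Prod>j<m. norm (F (z j)) powr (\<eta> - 2))"
        using Fz by (auto simp: exp_sum powr_def intro!: prod.cong)
      finally have "ennreal (exp (- 2 * real m * L)) \<le> ennreal (\<Prod>j<m. norm (F (z j)) powr (\<eta> - 2))"
        by (rule ennreal_leI)
      also have "\<dots> = (\<Prod>j<m. ennreal (norm (F (z j)) powr (\<eta> - 2)))"
        by (rule prod_ennreal[symmetric]) simp
      also have "\<dots> \<le> (\<Prod>j<m. \<psi> (norm (F (z j))))"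
        unfolding \<psi>_def using Fz \<eta> by (intro prod_mono_ennreal powr_le_power_majorant) auto
      also have "\<dots> = G \<omega>"
      proof -
        have "F (z j) = (\<Sum>n. \<phi> (n + m) \<omega> * of_real (a (real (n + m))) * z j ^ (n + m))
              + (\<Sum>n<m. \<phi> n \<omega> * of_real (a (real n)) * z j ^ n)" for j
          unfolding F_def gaussian_series_def
          by (intro suminf_split_initial_segment summable_in_conv_radius) (simp add: conv)
        thus ?thesis by (simp add: G_def)
      qed
      finally show False using not \<omega>M by (simp add: good_def)
    qed
  qed
  hence "prob H \<le> prob ((\<Union>n. large n) \<union> small \<union> good)" by (intro finite_measure_mono) auto
  also have "\<dots> \<le> prob ((\<Union>n. large n) \<union> small) + prob good" by (rule measure_Un_le) auto
  also have "prob ((\<Union>n. large n) \<union> small) \<le> prob (\<Union>n. large n) + prob small" by (rule measure_Un_le) auto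
  finally have PH: "prob H \<le> prob (\<Union>n. large n) + prob small + prob good" by simp

  have "prob (\<Union>n. large n) \<le> exp (- 2 * s)"
  proof -
    have b: "prob (large n) \<le> exp (- 2 * s) * ((1 / 2) * (1 / 2) ^ n)" for n
    proof -
      define x where "x = 2 * s + real n + 2"
      have x: "x \<ge> 2" using s by (simp add: x_def)
      have "prob (large n) \<le> 2 * exp (- x\<^sup>2 / 2)"
        unfolding large_def x_def[symmetric] using x by (intro prob_\<phi>_large_le) simp
      also have "exp (- x\<^sup>2 / 2) \<le> exp (- x)"
        using mult_right_mono[of 2 x x] x by (simp add: power2_eq_square)
      also have "exp (- x) = exp (- 2 * s) * exp (-1) ^ (n + 2)"
        by (simp add: x_def flip: exp_of_nat_mult exp_add)
      also have "exp (-1 :: real) ^ (n + 2) \<le> (1 / 2) ^ (n + 2)"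
        using exp_ge_add_one_self[of 1] by (intro power_mono) (auto simp: exp_minus field_simps)
      finally show ?thesis by (simp add: power_add mult_ac)
    qed
    have sums: "(\<lambda>n. exp (- 2 * s) * ((1 / 2) * (1 / 2) ^ n)) sums (exp (- 2 * s) * ((1 / 2) * (1 / (1 - 1 / 2))))"
      by (intro sums_mult geometric_sums) simp
    have sl: "summable (\<lambda>n. prob (large n))"
      by (rule summable_comparison_test'[OF sums_summable[OF sums], of 0]) (use b in auto)
    have "prob (\<Union>n. large n) \<le> (\<Sum>n. prob (large n))"
      by (rule finite_measure_subadditive_countably) (use sl in auto)
    also have "\<dots> \<le> exp (- 2 * s)"
      using suminf_le[OF b sl sums_summable[OF sums]] sums_unique[OF sums] by simp
    finally show ?thesis .
  qed
  moreover have "prob small \<le> exp (- 2 * s) / (a 0)\<^sup>2"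
    unfolding small_def using prob_\<phi>_small_le[of "exp (- s) / a 0" 0] a_pos[of 0]
    by (simp add: power_divide flip: exp_of_nat_mult)
  moreover have "prob good \<le> exp (- s - min 0 (2 * ln (a 0)) + real m * (6 * ln s + 20))"
  proof -
    define e where "e = exp (- 2 * real m * L)"
    have e: "e > 0" by (simp add: e_def)
    define D where "D = (\<Prod>n<m. a (real n) * (q * r) ^ n)"
    have D: "D > 0" unfolding D_def using q rp a_pos by (intro prod_pos) auto
    define I where "I = 8 * exp 1 * s"
    \<comment> \<open>Markov's inequality for G.\<close>
    have "ennreal e * emeasure M good = (\<integral>\<^sup>+\<omega>. ennreal e * indicator good \<omega> \<partial>M)"
      by (simp add: nn_integral_cmult_indicator)
    also have "\<dots> \<le> (\<integral>\<^sup>+\<omega>. G \<omega> \<partial>M)"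
      by (intro nn_integral_mono) (auto simp: good_def e_def indicator_def)
    also have "\<dots> \<le> (ennreal (1 / pi) * (\<integral>\<^sup>+w. \<psi> (norm (w::complex)) \<partial>lborel)) ^ m * ennreal (1 / D\<^sup>2)"
      unfolding G_def D_def z_def using q rp by (intro nn_integral_prod_circle_le m) auto
    also have "\<dots> \<le> ennreal I ^ m * ennreal (1 / D\<^sup>2)"
    proof (intro mult_right_mono power_mono)
      have "ennreal (1 / pi) * (\<integral>\<^sup>+w. \<psi> (norm (w::complex)) \<partial>lborel)
          \<le> ennreal (1 / pi) * ennreal (8 * pi * exp s powr \<eta> / \<eta>)"
        unfolding \<psi>_def using s by (intro mult_left_mono nn_integral_power_majorant_le) (auto simp: \<eta>_def)
      also have "\<dots> = ennreal I"
        using s by (simp add: I_def \<eta>_def powr_def flip: ennreal_mult)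
      finally show "ennreal (1 / pi) * (\<integral>\<^sup>+w. \<psi> (norm (w::complex)) \<partial>lborel) \<le> ennreal I" .
    qed auto
    also have "\<dots> = ennreal (I ^ m / D\<^sup>2)"
      using s by (simp add: I_def ennreal_power flip: ennreal_mult)
    finally have "e * prob good \<le> I ^ m / D\<^sup>2"
      using e s by (simp add: emeasure_eq_measure I_def flip: ennreal_mult)
    hence "prob good \<le> exp (2 * real m * L) * (I ^ m * (1 / D\<^sup>2))"
      using e by (simp add: e_def exp_minus field_simps)
    also have "I ^ m = exp (real m * (ln 8 + 1 + ln s))"
      using s by (simp add: I_def exp_of_nat_mult exp_add mult_ac)
    also have "1 / D\<^sup>2 \<le> exp (- s - min 0 (2 * ln (a 0)) + real m * ln s)"
    proof -
      \<comment> \<open>Passing from radius r to q r costs q^(m (m - 1)) = s^(-(m - 1)) in D^2,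
        since q^m = 1 / s.\<close>
      have "D = (\<Prod>n<m. exp (h r n)) * (\<Prod>n<m. q ^ n)"
        unfolding D_def exp_h[OF rp] prod.distrib[symmetric] by (simp add: power_mult_distrib mult_ac)
      also have "(\<Prod>n<m. q ^ n) = q ^ (\<Sum>n<m. n)" by (simp add: power_sum)
      finally have "D\<^sup>2 = exp (2 * (\<Sum>n<m. h r n)) * q ^ (2 * (\<Sum>n<m. n))"
        by (simp add: power_mult_distrib exp_sum exp_double power_mult[symmetric] mult.commute)
      also have "2 * (\<Sum>n<m. n) = m * (m - 1)"
        using Sum_Icc_nat[of 0 "m - 1"] m by (simp add: lessThan_Suc_atMost m_def atLeast0AtMost)
      also have "q ^ (m * (m - 1)) = (1 / s) ^ (m - 1)" by (simp add: power_mult q)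
      finally have D2: "1 / D\<^sup>2 = exp (- 2 * (\<Sum>n<m. h r n)) * s ^ (m - 1)"
        using s D by (simp add: exp_minus field_simps power_divide)
      have "s ^ (m - 1) \<le> s ^ m" using s by (intro power_increasing) auto
      also have "s ^ m = exp (real m * ln s)" using s by (simp add: exp_of_nat_mult)
      finally have "1 / D\<^sup>2 \<le> exp (- 2 * (\<Sum>n<m. h r n)) * exp (real m * ln s)"
        unfolding D2 by (intro mult_left_mono) auto
      also have "\<dots> \<le> exp (- s - min 0 (2 * ln (a 0)) + real m * ln s)"
        using sum_h_ge_S[OF r] by (simp add: m_def s_def flip: exp_add)
      finally show ?thesis .
    qed
    \<comment> \<open>Of the 6 ln s, four come from 2 L, one from I and one from D; the constants
      are 16, 1 and ln 8.\<close>
    also have "exp (2 * real m * L) * (exp (real m * (ln 8 + 1 + ln s)) * exp (- s - min 0 (2 * ln (a 0)) + real m * ln s))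
      = exp (- s - min 0 (2 * ln (a 0)) + real m * (6 * ln s + 17 + ln 8))"
      by (simp add: L_def algebra_simps flip: exp_add)
    also have "\<dots> \<le> exp (- s - min 0 (2 * ln (a 0)) + real m * (6 * ln s + 20))"
    proof -
      have "ln (8::real) \<le> 3"
        using exp_ge_add_one_self[of 1] ln_realpow[of 2 3] ln_2_less_1 by simp
      thus ?thesis by (simp add: mult_left_mono)
    qed
    finally show ?thesis by (simp add: mult_left_mono)
  qed
  ultimately show ?thesis
    using PH by (simp add: P_H_def H_def s_def m_def algebra_simps add_divide_distrib)
qed

end

section \<open>Asymptotics of the hole probability\<close>

text \<open>The hypotheses and error terms of \<open>P_H_le\<close> in terms of s = S alone: N is
  replaced by s where this is harmless, and by its true order s^(1/2 + e/2) in the main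
  error.\<close>

lemma asymptotics_lower:
  fixes a0 c0 e :: real
  assumes "a0 > 0" "e > 0"
  shows "eventually (\<lambda>s. 2 \<le> s \<and> (2 * s + 2) * a0 \<le> s ^ 2 \<and>
     (2 * s + 2) * a0 + (s * ((2 * s + s + 2) * exp (s / 2)) + (2 * s + s + 3) * (4 / (1 / (8 * s))\<^sup>2)) \<le> exp s \<and>
     (1 + 1 / a0\<^sup>2) * exp (- s) \<le> 1 / 2 \<and>
     - c0 + 2 * s powr (1 / 2 + e / 2) * (6 * ln s + 20) + ln 2 \<le> s powr (1 / 2 + e)) at_top"
  using assms by (intro eventually_conj; real_asymp)

text \<open>The square is of order s^(4 e), and 4 e \<le> 2/5 < 1/2. Replacing 2 e by 1/5 first
  leaves a fixed exponent to compare.\<close>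

lemma asymptotics_upper:
  fixes a0 e :: real
  assumes "a0 > 0" "e > 0" "e \<le> 1 / 10"
  shows "eventually (\<lambda>s. ((2 + 768 * s powr (2 * e)) / a0 + 2)\<^sup>2 + s powr (1 / 2 + e / 2) * (1 + 2 * ln s) + ln 2
     \<le> s powr (1 / 2 + e)) at_top"
proof -
  have "eventually (\<lambda>s. ((2 + 768 * s powr (1 / 5)) / a0 + 2)\<^sup>2 + ln 2 \<le> s powr (1 / 2)) at_top"
    using assms by real_asymp
  moreover have "eventually (\<lambda>s. 1 + s powr (e / 2) * (1 + 2 * ln s) \<le> s powr e) at_top"
    using assms by real_asymp
  ultimately show ?thesis using eventually_ge_at_top[of 1]
  proof eventually_elim
    case (elim s)
    have "s powr (2 * e) \<le> s powr (1 / 5)" using assms elim by (intro powr_mono) auto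
    hence "((2 + 768 * s powr (2 * e)) / a0 + 2)\<^sup>2 \<le> ((2 + 768 * s powr (1 / 5)) / a0 + 2)\<^sup>2"
      using assms by (intro power_mono add_right_mono divide_right_mono) auto
    with elim(1) have "((2 + 768 * s powr (2 * e)) / a0 + 2)\<^sup>2 + ln 2 \<le> s powr (1 / 2)" by simp
    moreover have "s powr (1 / 2) * (1 + s powr (e / 2) * (1 + 2 * ln s)) \<le> s powr (1 / 2) * s powr e"
      using elim(2) by (rule mult_left_mono) simp
    hence "s powr (1 / 2) + s powr (1 / 2 + e / 2) * (1 + 2 * ln s) \<le> s powr (1 / 2 + e)"
      by (simp add: powr_add algebra_simps)
    ultimately show ?case by linarith
  qed
qed

context gaussian_entire_function
begin

lemma p_H_bounds:
  assumes r: "r \<ge> R0" and e: "0 < e" "e \<le> 1 / 10"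
    and N: "(real (N r))\<^sup>2 \<le> S a r powr (1 + e)"
    and S2: "2 \<le> S a r" and a0: "(2 * S a r + 2) * a 0 \<le> S a r ^ 2"
    and upper: "(2 * S a r + 2) * a 0 + (S a r * ((2 * S a r + S a r + 2) * exp (S a r / 2))
        + (2 * S a r + S a r + 3) * (4 / (1 / (8 * S a r))\<^sup>2)) \<le> exp (S a r)"
    and l1: "(1 + 1 / (a 0)\<^sup>2) * exp (- S a r) \<le> 1 / 2"
    and l2: "- min 0 (2 * ln (a 0)) + 2 * S a r powr (1 / 2 + e / 2) * (6 * ln (S a r) + 20) + ln 2 \<le> S a r powr (1 / 2 + e)"
    and u: "((2 + 768 * S a r powr (2 * e)) / a 0 + 2)\<^sup>2 + S a r powr (1 / 2 + e / 2) * (1 + 2 * ln (S a r)) + ln 2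
       \<le> S a r powr (1 / 2 + e)"
  shows "ereal (S a r - S a r powr (1 / 2 + e)) \<le> p_H M \<phi> a r"
    and "p_H M \<phi> a r \<le> ereal (S a r + S a r powr (1 / 2 + e))"
proof -
  define s where "s = S a r"
  define n where "n = real (N r)"
  define X where "X = s powr (1 / 2 + e)"
  have s: "s \<ge> 2" "s > 0" "s \<ge> 1" "ln s \<ge> 0" using S2 by (auto simp: s_def)
  have n: "n \<ge> 1" using N_ge_1[OF r] by (simp add: n_def)
  have a0p: "a 0 > 0" by (rule a_pos) simp
  have nle: "n \<le> s powr (1 / 2 + e / 2)"
  proof (rule power2_le_imp_le)
    have "(s powr (1 / 2 + e / 2))\<^sup>2 = s powr (1 + e)"
      by (simp add: power2_eq_square flip: powr_add)
    thus "n\<^sup>2 \<le> (s powr (1 / 2 + e / 2))\<^sup>2" using N by (simp add: n_def s_def)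
  qed simp
  also have "s powr (1 / 2 + e / 2) \<le> s powr 1" using s e by (intro powr_mono) auto
  finally have ns: "n \<le> s" using s by simp
  have one: "1 \<le> s powr (1 / 2 + e / 2)" using s e by (intro ge_one_powr_ge_zero) auto
  have X0: "X \<ge> 0" by (simp add: X_def)

  have "(2 * s + 2) * a 0 + (n * ((2 * s + n + 2) * exp (s / 2)) + (2 * s + n + 3) * (4 / (1 / (8 * s))\<^sup>2))
    \<le> (2 * s + 2) * a 0 + (s * ((2 * s + s + 2) * exp (s / 2)) + (2 * s + s + 3) * (4 / (1 / (8 * s))\<^sup>2))"
    using ns n s a0p by (intro add_mono mult_mono) auto
  also have "\<dots> \<le> exp s" using upper by (simp add: s_def)
  finally have "P_H M \<phi> a r \<le> (1 + 1 / (a 0)\<^sup>2) * exp (- 2 * s)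
      + exp (- s - min 0 (2 * ln (a 0)) + (n + 1) * (6 * ln s + 20))"
    unfolding s_def n_def using ns s by (intro P_H_le[OF r S2 _ a0]) (auto simp: s_def n_def)
  \<comment> \<open>Each of the two summands is bounded by half of exp(-s + X).\<close>
  also have "(1 + 1 / (a 0)\<^sup>2) * exp (- 2 * s) \<le> exp (- s + X) / 2"
  proof -
    have "(1 + 1 / (a 0)\<^sup>2) * exp (- 2 * s) = exp (- s) * ((1 + 1 / (a 0)\<^sup>2) * exp (- s))"
      by (simp flip: exp_add)
    also have "\<dots> \<le> exp (- s) * (1 / 2)" using l1 by (intro mult_left_mono) (auto simp: s_def)
    also have "\<dots> \<le> exp (- s + X) / 2" using X0 by simp
    finally show ?thesis .
  qed
  also have "exp (- s - min 0 (2 * ln (a 0)) + (n + 1) * (6 * ln s + 20)) \<le> exp (- s + X) / 2"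
  proof -
    have "(n + 1) * (6 * ln s + 20) \<le> 2 * s powr (1 / 2 + e / 2) * (6 * ln s + 20)"
      using nle one s by (intro mult_right_mono) auto
    hence "- s - min 0 (2 * ln (a 0)) + (n + 1) * (6 * ln s + 20) \<le> - s + X - ln 2"
      using l2 by (simp add: s_def X_def)
    hence "exp (- s - min 0 (2 * ln (a 0)) + (n + 1) * (6 * ln s + 20)) \<le> exp (- s + X - ln 2)" by simp
    thus ?thesis by (simp add: exp_diff)
  qed
  finally have le: "P_H M \<phi> a r \<le> exp (- s + X)" by simp

  \<comment> \<open>From (N + 1)^2 \<le> 4 s^(1 + e), the rate S / (2 (N + 1)^2) of
    \<open>h_tail\<close> is at least this.\<close>
  define \<delta> where "\<delta> = s powr (- e) / 8"
  \<comment> \<open>768 s^(2 e) = 12 / \<delta>^2, so K a(0) exceeds the bound required by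
    \<open>P_H_ge\<close> by 1.\<close>
  define K where "K = (2 + 768 * s powr (2 * e)) / a 0"
  have "s powr (- e) \<le> 1" using s e by (simp add: powr_minus ge_one_powr_ge_zero inverse_le_1_iff)
  hence \<delta>: "0 < \<delta>" "\<delta> \<le> 1" using s by (auto simp: \<delta>_def)
  have tail: "h r (Suc (N r) + k) \<le> - real k * \<delta>" for k
  proof -
    have "(n + 1)\<^sup>2 \<le> (2 * s powr (1 / 2 + e / 2))\<^sup>2"
      using nle one n by (intro power_mono) auto
    also have "\<dots> = 4 * s powr (1 + e)" by (simp add: power2_eq_square flip: powr_add)
    finally have "\<delta> * (2 * (n + 1)\<^sup>2) \<le> \<delta> * (2 * (4 * s powr (1 + e)))"
      using \<delta> by (intro mult_left_mono) auto
    also have "\<dots> = s" using s by (simp add: \<delta>_def flip: powr_add)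
    finally have "\<delta> \<le> s / (2 * (n + 1)\<^sup>2)" using n by (subst pos_le_divide_eq) auto
    hence "real k * \<delta> \<le> real k * (s / (2 * (n + 1)\<^sup>2))" by (intro mult_left_mono) auto
    thus ?thesis using h_tail[OF r, of k] by (simp add: s_def n_def)
  qed
  have "12 / \<delta>\<^sup>2 = 768 * s powr (2 * e)"
    using s by (simp add: \<delta>_def power2_eq_square powr_minus field_simps flip: powr_add)
  hence K: "K \<ge> 0" "1 + 12 / \<delta>\<^sup>2 < K * a 0" using a0p by (auto simp: K_def)
  have "exp (- s - X) \<le> exp (- (K + 2)\<^sup>2 - s - n * (1 + 2 * ln n)) / 2"
  proof -
    have "n * (1 + 2 * ln n) \<le> s powr (1 / 2 + e / 2) * (1 + 2 * ln s)"
      using nle ns n s by (intro mult_mono) auto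
    hence "- s - X \<le> - (K + 2)\<^sup>2 - s - n * (1 + 2 * ln n) - ln 2"
      using u by (simp add: K_def X_def s_def)
    hence "exp (- s - X) \<le> exp (- (K + 2)\<^sup>2 - s - n * (1 + 2 * ln n) - ln 2)" by simp
    thus ?thesis by (simp add: exp_diff)
  qed
  also have "\<dots> \<le> P_H M \<phi> a r"
    using P_H_ge[OF r \<delta> tail K] by (simp add: s_def n_def)
  finally have ge: "exp (- s - X) \<le> P_H M \<phi> a r" .
  \<comment> \<open>Positivity puts \<open>p_H\<close> in the finite branch of its
    definition.\<close>
  hence pos: "P_H M \<phi> a r > 0" by (rule less_le_trans[rotated]) simp
  have "- s - X \<le> ln (P_H M \<phi> a r)" "ln (P_H M \<phi> a r) \<le> - s + X"
    using pos ge le ln_le_cancel_iff[of "exp (- s - X)" "P_H M \<phi> a r"] ln_le_cancel_iff[of "P_H M \<phi> a r" "exp (- s + X)"] by simp_all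
  thus "ereal (S a r - S a r powr (1 / 2 + e)) \<le> p_H M \<phi> a r"
    "p_H M \<phi> a r \<le> ereal (S a r + S a r powr (1 / 2 + e))"
    using pos by (simp_all add: p_H_def s_def X_def)
qed

lemma p_H_asymptotics:
  assumes \<epsilon>: "\<epsilon> > 0"
  shows "\<exists>E. finite_log_measure E \<and> (\<forall>r\<in>{1..} - E.
     ereal (S a r - S a r powr (0.9 + \<epsilon>)) \<le> p_H M \<phi> a r \<and>
     p_H M \<phi> a r \<le> ereal (S a r + S a r powr (0.5 + \<epsilon>)))"
proof -
  \<comment> \<open>\<open>asymptotics_upper\<close> requires e \<le> 1/10. Larger exponents follow
    because S \<ge> 1 outside E.\<close>
  define e where "e = min \<epsilon> (1 / 10)"
  have e: "0 < e" "e \<le> 1 / 10" "e \<le> \<epsilon>" using \<epsilon> by (auto simp: e_def)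
  have a0: "a 0 > 0" by (rule a_pos) simp
  note ev = eventually_conj[OF asymptotics_lower[OF a0 e(1), of "min 0 (2 * ln (a 0))"] asymptotics_upper[OF a0 e(1,2)]]
  obtain E where E: "finite_log_measure E"
    "\<And>r. r \<ge> 1 \<Longrightarrow> r \<notin> E \<Longrightarrow> p_H M \<phi> a r \<le> ereal (S a r + S a r powr (1 / 2 + e)) \<and>
        ereal (S a r - S a r powr (1 / 2 + e)) \<le> p_H M \<phi> a r \<and> S a r \<ge> 1"
  proof (rule exceptional_set[OF e(1) ev])
    fix E assume E: "finite_log_measure E" and *: "\<And>r. 1 \<le> r \<Longrightarrow> r \<notin> E \<Longrightarrow> R0 \<le> r \<and> (real (N r))\<^sup>2 \<le> S a r powr (1 + e) \<and>
      (2 \<le> S a r \<and> (2 * S a r + 2) * a 0 \<le> S a r ^ 2 \<and>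
       (2 * S a r + 2) * a 0 + (S a r * ((2 * S a r + S a r + 2) * exp (S a r / 2)) + (2 * S a r + S a r + 3) * (4 / (1 / (8 * S a r))\<^sup>2)) \<le> exp (S a r) \<and>
       (1 + 1 / (a 0)\<^sup>2) * exp (- S a r) \<le> 1 / 2 \<and>
       - min 0 (2 * ln (a 0)) + 2 * S a r powr (1 / 2 + e / 2) * (6 * ln (S a r) + 20) + ln 2 \<le> S a r powr (1 / 2 + e)) \<and>
       ((2 + 768 * S a r powr (2 * e)) / a 0 + 2)\<^sup>2 + S a r powr (1 / 2 + e / 2) * (1 + 2 * ln (S a r)) + ln 2 \<le> S a r powr (1 / 2 + e)"
    show thesis
    proof (rule that[OF E])
      fix r assume r: "1 \<le> r" "r \<notin> E"
      from *[OF r] show "p_H M \<phi> a r \<le> ereal (S a r + S a r powr (1 / 2 + e)) \<and>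
        ereal (S a r - S a r powr (1 / 2 + e)) \<le> p_H M \<phi> a r \<and> S a r \<ge> 1"
        using p_H_bounds[of r e] e by auto
    qed
  qed
  show ?thesis
  proof (intro exI[of _ E] conjI ballI)
    fix r assume "r \<in> {1..} - E"
    hence r: "p_H M \<phi> a r \<le> ereal (S a r + S a r powr (1 / 2 + e))"
        "ereal (S a r - S a r powr (1 / 2 + e)) \<le> p_H M \<phi> a r" "S a r \<ge> 1" using E(2)[of r] by auto
    have "S a r powr (1 / 2 + e) \<le> S a r powr (0.9 + \<epsilon>)" "S a r powr (1 / 2 + e) \<le> S a r powr (0.5 + \<epsilon>)"
      using e r(3) by (auto intro!: powr_mono)
    thus "ereal (S a r - S a r powr (0.9 + \<epsilon>)) \<le> p_H M \<phi> a r" "p_H M \<phi> a r \<le> ereal (S a r + S a r powr (0.5 + \<epsilon>))"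
      using r(1,2) by (auto elim!: order_trans[rotated] intro: order_trans)
  qed (rule E(1))
qed

end

theorem theorem2:
  shows "\<exists>c1 c2 :: real. c1 > 0 \<and> c2 > 0 \<and>
    (\<forall>(\<alpha> :: real) (a :: real \<Rightarrow> real) (M :: 'w measure) (\<phi> :: nat \<Rightarrow> 'w \<Rightarrow> complex).
       \<alpha> \<ge> 1 \<longrightarrow>
       (\<forall>t\<ge>0. a t > 0) \<longrightarrow>
       concave_on {0..} (\<lambda>t. ln (a t)) \<longrightarrow>
       C2_on {0<..} a \<longrightarrow>
       filterlim (\<lambda>t. ln (a t) / t) at_bot at_top \<longrightarrow>
       (\<forall>t\<ge>1. a t \<ge> exp (- t * (ln t) powr \<alpha>)) \<longrightarrow>
       prob_space M \<longrightarrow>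
       indep_std_complex_gaussians M \<phi> \<longrightarrow>
       (\<forall>\<epsilon>>0. \<exists>E. finite_log_measure E \<and>
          (\<forall>r\<in>{1..} - E.
             ereal (S a r - c1 * S a r powr (0.9 + \<epsilon>)) \<le> p_H M \<phi> a r \<and>
             p_H M \<phi> a r \<le> ereal (S a r + c2 * S a r powr (0.5 + \<epsilon>)))))"
proof (rule exI[of _ 1], rule exI[of _ 1], intro conjI allI impI)
  \<comment> \<open>The constants are c1 = c2 = 1: factors depending on a(0) are absorbed into a
    power of S by enlarging E.\<close>
  fix \<alpha> :: real and a :: "real \<Rightarrow> real" and M :: "'w measure" and \<phi> :: "nat \<Rightarrow> 'w \<Rightarrow> complex" and \<epsilon> :: real
  assume "\<forall>t\<ge>0. a t > 0" "concave_on {0..} (\<lambda>t. ln (a t))"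
    "filterlim (\<lambda>t. ln (a t) / t) at_bot at_top" "prob_space M" "indep_std_complex_gaussians M \<phi>"
  then interpret gaussian_entire_function a M \<phi>
    by (simp add: gaussian_entire_function_def log_concave_weights_def gaussian_coefficients_def gaussian_coefficients_axioms_def)
  assume "\<epsilon> > 0"
  thus "\<exists>E. finite_log_measure E \<and>
          (\<forall>r\<in>{1..} - E.
             ereal (S a r - 1 * S a r powr (0.9 + \<epsilon>)) \<le> p_H M \<phi> a r \<and>
             p_H M \<phi> a r \<le> ereal (S a r + 1 * S a r powr (0.5 + \<epsilon>)))"
    using p_H_asymptotics by simp
qed simp_all

end
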